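(* For any $\epsilon>0$, there is a two-sided adaptive algorithm for $\epsilon$-testing Decision List with respect to the uniform distribution that makes $\tilde O(1/\epsilon)$ queries.
   Context: Boolean functions $f:\{0,1\}^n\to\{0,1\}$ are accessed through a membership-query oracle that returns $f(x)$ for a queried $x$. $f$ is $\epsilon$-far from a class $C$ (with respect to the uniform distribution) if $\Pr_{x}[f(x)\neq g(x)]\ge\epsilon$ for every $g\in C$, with $x$ uniform on $\{0,1\}^n$. A two-sided adaptive algorithm for $\epsilon$-testing $C$ is a randomized algorithm that, given $\epsilon$ and membership-query access to an arbitrary $f$ (and able to draw uniform random strings), chooses queries possibly adaptively, accepts with probability at least $2/3$ if $f\in C$, and rejects with probability at least $2/3$ if $f$ is $\epsilon$-far from every function in $C$. $\tilde O(T)$ means $O(T\cdot\mathrm{poly}(\log T))$. A decision list is a sequence $(x_{i_1},\xi_1,a_1),\dots,(x_{i_s},\xi_s,a_s)$ (any $s$) with $\xi_j,a_j\in\{0,1\}$, representing the function: if $x_{i_1}=\xi_1$ output $a_1$, else if $x_{i_2}=\xi_2$ output $a_2$, \dots, else if $x_{i_s}=\xi_s$ output $a_s$. Decision List is the class of all decision lists. *)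

theory Defs
  imports "HOL-Probability.Probability" "HOL-Computational_Algebra.Polynomial"
begin

definition cube :: "nat \<Rightarrow> (nat \<Rightarrow> bool) set" where
  "cube n = {..<n} \<rightarrow>\<^sub>E UNIV"

text \<open>
  A triple \<open>(i, \<xi>, a)\<close> reads ``if \<open>x i = \<xi>\<close> then output \<open>a\<close>''. There is no default
  output: a list on which some point falls through represents no Boolean function. A default
  value \<open>a\<close> is expressed by ending the list with \<open>(i, False, a), (i, True, a)\<close>.
\<close>

type_synonym decision_list = "(nat \<times> bool \<times> bool) list"

fun dl_eval :: "decision_list \<Rightarrow> (nat \<Rightarrow> bool) \<Rightarrow> bool option" where
  "dl_eval [] x = None"
| "dl_eval ((i, \<xi>, a) # L) x = (if x i = \<xi> then Some a else dl_eval L x)"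

definition Decision_List :: "nat \<Rightarrow> ((nat \<Rightarrow> bool) \<Rightarrow> bool) set" where
  "Decision_List n =
    {f. \<exists>L. (\<forall>(i, \<xi>, a) \<in> set L. i < n) \<and> (\<forall>x \<in> cube n. dl_eval L x = Some (f x))}"

definition far :: "nat \<Rightarrow> real \<Rightarrow> ((nat \<Rightarrow> bool) \<Rightarrow> bool) set \<Rightarrow> ((nat \<Rightarrow> bool) \<Rightarrow> bool) \<Rightarrow> bool" where
  "far n \<epsilon> C f \<longleftrightarrow>
    (\<forall>g \<in> C. measure_pmf.prob (pmf_of_set (cube n)) {x. f x \<noteq> g x} \<ge> \<epsilon>)"

text \<open>
  Randomized adaptive oracle algorithms, as finite trees: \<open>Query x k\<close> asks the oracle for its
  value at \<open>x\<close>, \<open>Flip k\<close> tosses a fair coin, and in both cases the computation goes on with \<open>k\<close>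
  applied to the outcome. Drawing a uniform random string of length \<open>m\<close> amounts to \<open>m\<close> tosses.
\<close>

datatype (query_points: 'x) oracle_alg =
    Return bool
  | Query 'x "bool \<Rightarrow> 'x oracle_alg"
  | Flip "bool \<Rightarrow> 'x oracle_alg"

primrec run :: "'x oracle_alg \<Rightarrow> ('x \<Rightarrow> bool) \<Rightarrow> bool pmf" where
  "run (Return b) f = return_pmf b"
| "run (Query x k) f = run (k (f x)) f"
| "run (Flip k) f = bind_pmf (bernoulli_pmf (1/2)) (\<lambda>b. run (k b) f)"

text \<open>Worst case over all coin tosses and all oracle answers; coin tosses are free.\<close>

primrec num_queries :: "'x oracle_alg \<Rightarrow> nat" where
  "num_queries (Return b) = 0"
| "num_queries (Query x k) = Suc (max (num_queries (k False)) (num_queries (k True)))"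
| "num_queries (Flip k) = max (num_queries (k False)) (num_queries (k True))"

definition two_sided_tester ::
  "nat \<Rightarrow> real \<Rightarrow> ((nat \<Rightarrow> bool) \<Rightarrow> bool) set \<Rightarrow> (nat \<Rightarrow> bool) oracle_alg \<Rightarrow> bool" where
  "two_sided_tester n \<epsilon> C A \<longleftrightarrow>
    query_points A \<subseteq> cube n \<and>
    (\<forall>f \<in> C. pmf (run A f) True \<ge> 2/3) \<and>
    (\<forall>f. far n \<epsilon> C f \<longrightarrow> pmf (run A f) False \<ge> 2/3)"

end

theory Submission
  imports Defs
begin

text \<open>
  A random point passes \<open>k\<close> entries of a decision list with probability \<open>2 ^ -k\<close>, so up to an error
  polynomially small in \<open>\<epsilon>\<close> only \<open>k = O(log (1/\<epsilon>))\<close> variables matter. Split the variables at random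
  into \<open>r = O(k\<^sup>2)\<close> blocks, which separates these. A random pair \<open>w, w'\<close> of points that agree outside
  block \<open>j\<close> and have different values yields a point \<open>w\<close> such that \<open>f\<close>, as a function \<open>F\<^sub>j\<close> of block \<open>j\<close>
  around \<open>w\<close>, is a literal; blocks for which no such pair turns up can be ignored. So a short list over
  the block values \<open>F\<^sub>j\<close> agrees with \<open>f\<close> on all samples.

  Conversely, a linearity test together with a test that fails for parities of two or more variables
  guarantees that each \<open>F\<^sub>j\<close> is close to a function of a single variable. Then every list over the
  \<open>F\<^sub>j\<close> is close to a decision list, hence far from \<open>f\<close>, and a union bound over the \<open>2 ^ O(k log r)\<close>
  lists shows that none survives the samples. Every potential query is uniformly distributed, so in
  the completeness proof \<open>f\<close> may be replaced by its truncation.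
\<close>

section \<open>Relative frequencies in finite sets\<close>

text \<open>The bound is linear in 1 / \<epsilon> because only the error budget of the block
  functions scales with it: \<open>r\<close> functions may be wrong on a fraction \<epsilon> / 2
  altogether, so each is tested to accuracy about \<epsilon> / r, and all other factors are
  polynomial in \<open>k\<close>. The searches need not find every relevant block: one that is
  sensitive with probability p stays unfound and then spoils a sample with probability p (1 - p)^S,
  which is small for every p. Soundness does not depend on the success of the searches; it holds for
  every partition and every selection, because the samples are independent of both. The obstacle in
  completeness is that the selected pair depends on the function, so the actual queries need not be
  uniform given the selection; all pairs that could be selected are counted instead. Their number is
  quadratic in 1 / \<epsilon> up to logarithms, but it affects only \<open>k\<close>, and that
  logarithmically.\<close>

definition freq :: "'a set \<Rightarrow> ('a \<Rightarrow> bool) \<Rightarrow> real" where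
  "freq A P = real (card {x \<in> A. P x}) / real (card A)"

lemma freq_nonneg: "0 \<le> freq A P"
  by (simp add: freq_def)

lemma freq_cong: "(\<And>x. x \<in> A \<Longrightarrow> P x = Q x) \<Longrightarrow> freq A P = freq A Q"
  unfolding freq_def by (metis (mono_tags, lifting) Collect_cong)

lemma freq_mono:
  assumes "finite A" "\<And>x. x \<in> A \<Longrightarrow> P x \<Longrightarrow> Q x"
  shows "freq A P \<le> freq A Q"
  unfolding freq_def
  by (intro divide_right_mono) (auto intro!: card_mono simp: assms)

lemma freq_True: "finite A \<Longrightarrow> A \<noteq> {} \<Longrightarrow> freq A (\<lambda>_. True) = 1"
  by (simp add: freq_def)

lemma freq_False: "freq A (\<lambda>_. False) = 0"
  by (simp add: freq_def)

lemma freq_le_1: "freq A P \<le> 1"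
proof (cases "finite A \<and> A \<noteq> {}")
  case True
  then have "freq A P \<le> freq A (\<lambda>_. True)" by (intro freq_mono) auto
  then show ?thesis using True by (simp add: freq_True)
next
  case False
  then show ?thesis by (auto simp: freq_def)
qed

lemma freq_not:
  assumes "finite A" "A \<noteq> {}"
  shows "freq A (\<lambda>x. \<not> P x) = 1 - freq A P"
proof -
  have "card A = card {x \<in> A. P x} + card {x \<in> A. \<not> P x}"
    using assms by (subst card_Un_disjoint [symmetric]) (auto intro!: arg_cong [of _ _ card])
  moreover have "card A > 0" using assms by (simp add: card_gt_0_iff)
  ultimately show ?thesis
    unfolding freq_def by (simp add: diff_divide_distrib eq_diff_eq flip: add_divide_distrib of_nat_add)
qed

lemma freq_disj_le: "finite A \<Longrightarrow> freq A (\<lambda>x. P x \<or> Q x) \<le> freq A P + freq A Q"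
proof -
  assume "finite A"
  have "{x \<in> A. P x \<or> Q x} = {x \<in> A. P x} \<union> {x \<in> A. Q x}" by auto
  then have "card {x \<in> A. P x \<or> Q x} \<le> card {x \<in> A. P x} + card {x \<in> A. Q x}"
    by (metis card_Un_le)
  then show ?thesis
    unfolding freq_def by (simp add: add_divide_distrib [symmetric] divide_right_mono flip: of_nat_add)
qed

lemma freq_Bex_le:
  assumes "finite A" "finite I"
  shows "freq A (\<lambda>x. \<exists>i\<in>I. P i x) \<le> (\<Sum>i\<in>I. freq A (P i))"
  using assms(2)
proof (induction I rule: finite_induct)
  case empty
  then show ?case by (simp add: freq_False)
next
  case (insert i I)
  have "freq A (\<lambda>x. \<exists>j\<in>insert i I. P j x) = freq A (\<lambda>x. P i x \<or> (\<exists>j\<in>I. P j x))"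
    by (rule freq_cong) auto
  also have "\<dots> \<le> freq A (P i) + freq A (\<lambda>x. \<exists>j\<in>I. P j x)"
    by (rule freq_disj_le [OF assms(1)])
  finally show ?case using insert by simp
qed

lemma freq_Bex_le_card:
  assumes "finite A" "finite I" "\<And>i. i \<in> I \<Longrightarrow> freq A (P i) \<le> c"
  shows "freq A (\<lambda>x. \<exists>i\<in>I. P i x) \<le> real (card I) * c"
proof -
  have "(\<Sum>i\<in>I. freq A (P i)) \<le> real (card I) * c"
    using assms(3) by (rule sum_bounded_above)
  then show ?thesis using freq_Bex_le [OF assms(1,2), of P] by linarith
qed

lemma freq_less_1_ex:
  assumes "finite A" "A \<noteq> {}" "freq A (\<lambda>x. \<not> P x) < 1"
  shows "\<exists>x\<in>A. P x"
proof (rule ccontr)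
  assume "\<not> ?thesis"
  then have "freq A (\<lambda>x. \<not> P x) = freq A (\<lambda>_. True)" by (intro freq_cong) auto
  then show False using assms by (simp add: freq_True)
qed

lemma freq_bij: "bij_betw \<phi> A B \<Longrightarrow> freq A (\<lambda>x. P (\<phi> x)) = freq B P"
proof -
  assume bij: "bij_betw \<phi> A B"
  have "bij_betw \<phi> {x \<in> A. P (\<phi> x)} {x \<in> B. P x}"
    using bij unfolding bij_betw_def inj_on_def by auto
  then show ?thesis unfolding freq_def using bij by (simp add: bij_betw_same_card)
qed

section \<open>Product spaces: averaging and change of variables\<close>

lemma freq_Times:
  assumes "finite A" "finite B"
  shows "freq (A \<times> B) P = (\<Sum>a\<in>A. freq B (\<lambda>b. P (a, b))) / real (card A)"
proof -
  have "{x \<in> A \<times> B. P x} = (SIGMA a:A. {b \<in> B. P (a, b)})" by auto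
  then have "real (card {x \<in> A \<times> B. P x}) = (\<Sum>a\<in>A. real (card {b \<in> B. P (a, b)}))"
    using assms by (simp add: card_SigmaI)
  then show ?thesis
    unfolding freq_def by (simp add: card_cartesian_product mult.commute flip: sum_divide_distrib)
qed

lemma freq_swap:
  "freq (A \<times> B) (\<lambda>(a, b). P a b) = freq (B \<times> A) (\<lambda>(b, a). P a b)"
proof -
  have "bij_betw prod.swap (A \<times> B) (B \<times> A)"
    by (rule bij_betw_byWitness [of _ prod.swap]) auto
  from freq_bij [OF this, of "\<lambda>(b, a). P a b"] show ?thesis
    by (simp add: case_prod_unfold)
qed

lemma freq_Times_le:
  assumes "finite A" "finite B" "0 \<le> c" "\<And>a. a \<in> A \<Longrightarrow> freq B (\<lambda>b. P (a, b)) \<le> c"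
  shows "freq (A \<times> B) P \<le> c"
proof (cases "card A = 0")
  case True
  then show ?thesis using assms(3) by (simp add: freq_def card_cartesian_product)
next
  case False
  have "(\<Sum>a\<in>A. freq B (\<lambda>b. P (a, b))) \<le> real (card A) * c"
    using assms(4) by (rule sum_bounded_above)
  then show ?thesis using False by (simp add: freq_Times assms(1,2) divide_le_eq mult.commute)
qed

lemma freq_Times_ex:
  assumes "finite A" "finite B" "A \<noteq> {}" "freq (A \<times> B) P \<le> c"
  shows "\<exists>a\<in>A. freq B (\<lambda>b. P (a, b)) \<le> c"
proof (rule ccontr)
  assume "\<not> ?thesis"
  then have "(\<Sum>a\<in>A. c) < (\<Sum>a\<in>A. freq B (\<lambda>b. P (a, b)))"
    using assms by (intro sum_strict_mono) auto
  moreover have "card A > 0" using assms by (simp add: card_gt_0_iff)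
  ultimately show False using assms(4) by (simp add: freq_Times assms(1,2) field_simps)
qed

lemma freq_conj_Times:
  assumes "finite A" "finite B"
  shows "freq (A \<times> B) (\<lambda>(a, b). P a \<and> Q b) = freq A P * freq B Q"
proof -
  have "{x \<in> A \<times> B. case x of (a, b) \<Rightarrow> P a \<and> Q b} = {a \<in> A. P a} \<times> {b \<in> B. Q b}" by auto
  then show ?thesis by (simp add: freq_def card_cartesian_product)
qed

text \<open>Change of variables with the other component held fixed: equality is required fibre by
  fibre, so a substitution in \<open>b\<close> may depend on \<open>a\<close>, and \<open>B\<close>
  may be traded for another space \<open>B'\<close>.\<close>

lemma freq_Times_cong_snd:
  assumes "finite A" "finite B" "finite B'"
    "\<And>a. a \<in> A \<Longrightarrow> freq B (\<lambda>b. P (a, b)) = freq B' (\<lambda>b. Q (a, b))"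
  shows "freq (A \<times> B) P = freq (A \<times> B') Q"
  using assms by (simp add: freq_Times)

lemma freq_Times_cong_fst:
  assumes "finite A" "finite A'" "finite B"
    "\<And>b. b \<in> B \<Longrightarrow> freq A (\<lambda>a. P (a, b)) = freq A' (\<lambda>a. Q (a, b))"
  shows "freq (A \<times> B) P = freq (A' \<times> B) Q"
  using freq_Times_cong_snd [of B A A' "\<lambda>(b, a). P (a, b)" "\<lambda>(b, a). Q (a, b)"] assms
    freq_swap [of A B "\<lambda>a b. P (a, b)"] freq_swap [of A' B "\<lambda>a b. Q (a, b)"]
  by simp

lemma freq_fst:
  assumes "finite A" "finite B" "B \<noteq> {}"
  shows "freq (A \<times> B) (\<lambda>(a, b). P a) = freq A P"
  using freq_conj_Times [of A B P "\<lambda>_. True"] assms by (simp add: freq_True)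

lemma freq_snd:
  assumes "finite A" "finite B" "A \<noteq> {}"
  shows "freq (A \<times> B) (\<lambda>(a, b). P b) = freq B P"
  using freq_conj_Times [of A B "\<lambda>_. True" P] assms by (simp add: freq_True)

section \<open>Function spaces: independent uniform coordinates\<close>

lemma freq_PiE:
  assumes "finite I"
  shows "freq (I \<rightarrow>\<^sub>E A) (\<lambda>Y. \<forall>t\<in>I. P t (Y t)) = (\<Prod>t\<in>I. freq A (P t))"
proof -
  have "{Y \<in> I \<rightarrow>\<^sub>E A. \<forall>t\<in>I. P t (Y t)} = (\<Pi>\<^sub>E t\<in>I. {a \<in> A. P t a})"
    by (auto simp: PiE_iff extensional_def)
  then show ?thesis using assms by (simp add: freq_def card_PiE prod_dividef)
qed

lemma freq_PiE_at:
  assumes "finite I" "finite A" "A \<noteq> {}" "t \<in> I"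
  shows "freq (I \<rightarrow>\<^sub>E A) (\<lambda>Y. P (Y t)) = freq A P"
proof -
  have "freq (I \<rightarrow>\<^sub>E A) (\<lambda>Y. P (Y t)) = freq (I \<rightarrow>\<^sub>E A) (\<lambda>Y. \<forall>s\<in>I. s = t \<longrightarrow> P (Y s))"
    using assms by (intro freq_cong) auto
  also have "\<dots> = (\<Prod>s\<in>I. freq A (\<lambda>a. s = t \<longrightarrow> P a))"
    by (rule freq_PiE [OF assms(1)])
  also have "\<dots> = (\<Prod>s\<in>{t}. freq A (\<lambda>a. s = t \<longrightarrow> P a))"
    using assms by (intro prod.mono_neutral_right) (auto simp: freq_True)
  finally show ?thesis by simp
qed

text \<open>Union bound over the common value \<open>b\<close>: two independent coordinates both
  equal it with probability 1 / card B ^ 2.\<close>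

lemma freq_PiE_collision:
  assumes "finite I" "finite B" "B \<noteq> {}" "i \<in> I" "j \<in> I" "i \<noteq> j"
  shows "freq (I \<rightarrow>\<^sub>E B) (\<lambda>\<pi>. \<pi> i = \<pi> j) \<le> 1 / real (card B)"
proof -
  have fin: "finite (I \<rightarrow>\<^sub>E B)" using assms by (simp add: finite_PiE)
  have pos: "card B > 0" using assms by (simp add: card_gt_0_iff)
  have "freq (I \<rightarrow>\<^sub>E B) (\<lambda>\<pi>. \<pi> i = \<pi> j)
      \<le> freq (I \<rightarrow>\<^sub>E B) (\<lambda>\<pi>. \<exists>b\<in>B. \<forall>t\<in>I. t \<in> {i, j} \<longrightarrow> \<pi> t = b)"
    using assms by (intro freq_mono fin) (auto simp: PiE_iff)
  also have "\<dots> \<le> real (card B) * (1 / real (card B)) ^ 2"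
  proof (rule freq_Bex_le_card [OF fin assms(2)])
    fix b assume "b \<in> B"
    then have "{a \<in> B. a = b} = {b}" by auto
    then have b: "freq B (\<lambda>a. a = b) = 1 / real (card B)" by (simp add: freq_def)
    have "freq (I \<rightarrow>\<^sub>E B) (\<lambda>\<pi>. \<forall>t\<in>I. t \<in> {i, j} \<longrightarrow> \<pi> t = b)
        = (\<Prod>t\<in>I. freq B (\<lambda>a. t \<in> {i, j} \<longrightarrow> a = b))"
      by (rule freq_PiE [OF assms(1)])
    also have "\<dots> = (\<Prod>t\<in>{i, j}. freq B (\<lambda>a. t \<in> {i, j} \<longrightarrow> a = b))"
      using assms by (intro prod.mono_neutral_right) (auto simp: freq_True)
    also have "\<dots> = (1 / real (card B)) ^ 2"
      using assms b by (simp add: power2_eq_square)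
    finally show "freq (I \<rightarrow>\<^sub>E B) (\<lambda>\<pi>. \<forall>t\<in>I. t \<in> {i, j} \<longrightarrow> \<pi> t = b) \<le> (1 / real (card B)) ^ 2"
      by simp
  qed
  also have "\<dots> = 1 / real (card B)" using pos by (simp add: power2_eq_square)
  finally show ?thesis .
qed

text \<open>Each \<open>\<phi> t\<close> preserves the uniform distribution, so all events
  \<open>P (\<phi> t a)\<close> have the frequency of \<open>P\<close>; as they cover
  \<open>A\<close>, the union bound gives 1 \<le> card T * freq A P.\<close>

lemma freq_ge_if_bijections_cover:
  assumes "finite A" "A \<noteq> {}" "finite T"
    and bij: "\<And>t. t \<in> T \<Longrightarrow> bij_betw (\<phi> t) A A"
    and cover: "\<And>a. a \<in> A \<Longrightarrow> \<exists>t\<in>T. P (\<phi> t a)"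
  shows "1 / real (card T) \<le> freq A P"
proof -
  have "1 = freq A (\<lambda>_. True)" using assms by (simp add: freq_True)
  also have "\<dots> \<le> freq A (\<lambda>a. \<exists>t\<in>T. P (\<phi> t a))"
    using cover by (intro freq_mono assms) auto
  also have "\<dots> \<le> real (card T) * freq A P"
    by (intro freq_Bex_le_card assms) (simp add: freq_bij [OF bij])
  finally have "1 \<le> real (card T) * freq A P" .
  moreover have "card T > 0" using assms(2,3) cover by (auto simp: card_gt_0_iff)
  ultimately show ?thesis by (simp add: field_simps)
qed

section \<open>Operations on the cube\<close>

lemma finite_cube [simp]: "finite (cube n)"
  by (simp add: cube_def finite_PiE)

lemma cube_nonempty [simp]: "cube n \<noteq> {}"
  by (simp add: cube_def PiE_eq_empty_iff)

lemma card_cube: "card (cube n) = 2 ^ n"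
  by (simp add: cube_def card_PiE)

lemma cube_eqI: "x \<in> cube n \<Longrightarrow> y \<in> cube n \<Longrightarrow> (\<And>i. i < n \<Longrightarrow> x i = y i) \<Longrightarrow> x = y"
  unfolding cube_def by (rule PiE_ext) auto

text \<open>The block is a predicate on coordinates, so that a point of the cube can itself serve as
  a random mask, as in \<open>mix n z y x\<close>.\<close>

definition mix :: "nat \<Rightarrow> (nat \<Rightarrow> bool) \<Rightarrow> (nat \<Rightarrow> bool) \<Rightarrow> (nat \<Rightarrow> bool) \<Rightarrow> nat \<Rightarrow> bool" where
  "mix n B x y = (\<lambda>i\<in>{..<n}. if B i then y i else x i)"

definition vadd :: "nat \<Rightarrow> (nat \<Rightarrow> bool) \<Rightarrow> (nat \<Rightarrow> bool) \<Rightarrow> nat \<Rightarrow> bool" where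
  "vadd n x y = (\<lambda>i\<in>{..<n}. x i \<noteq> y i)"

lemma mix_cube [simp]: "mix n B x y \<in> cube n"
  by (simp add: mix_def cube_def)

lemma vadd_cube [simp]: "vadd n x y \<in> cube n"
  by (simp add: vadd_def cube_def)

lemma mix_apply: "i < n \<Longrightarrow> mix n B x y i = (if B i then y i else x i)"
  by (simp add: mix_def)

lemma vadd_apply: "i < n \<Longrightarrow> vadd n x y i = (x i \<noteq> y i)"
  by (simp add: vadd_def)

lemma bij_betw_mix_pair:
  "bij_betw (\<lambda>(x, y). (mix n B x y, mix n B y x)) (cube n \<times> cube n) (cube n \<times> cube n)"
  by (rule bij_betw_byWitness [of _ "\<lambda>(x, y). (mix n B x y, mix n B y x)"])
    (auto intro!: cube_eqI [of _ n] simp: mix_apply split: if_splits)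

lemma freq_mix_pair:
  "freq (cube n \<times> cube n) (\<lambda>(x, y). P (mix n B x y) (mix n B y x))
    = freq (cube n \<times> cube n) (\<lambda>(x, y). P x y)"
  using freq_bij [OF bij_betw_mix_pair, where P = "\<lambda>(x, y). P x y"] by (simp add: case_prod_unfold)

lemma freq_mix: "freq (cube n \<times> cube n) (\<lambda>(x, y). P (mix n B x y)) = freq (cube n) P"
  using freq_mix_pair [of n "\<lambda>x y. P x" B] by (simp add: freq_fst)

lemma bij_betw_vadd: "a \<in> cube n \<Longrightarrow> bij_betw (vadd n a) (cube n) (cube n)"
  by (rule bij_betw_byWitness [of _ "vadd n a"])
    (auto intro!: cube_eqI [of _ n] simp: vadd_apply)

lemma freq_vadd: "a \<in> cube n \<Longrightarrow> freq (cube n) (\<lambda>x. P (vadd n a x)) = freq (cube n) P"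
  by (rule freq_bij [OF bij_betw_vadd])

lemma vadd_commute: "vadd n x y = vadd n y x"
  by (auto simp: vadd_def)

lemma vadd_cancel: "x \<in> cube n \<Longrightarrow> vadd n a (vadd n a x) = x"
  by (rule cube_eqI [of _ n]) (auto simp: vadd_apply)

section \<open>A test for functions of a single coordinate\<close>

abbreviation triples :: "nat \<Rightarrow> ((nat \<Rightarrow> bool) \<times> (nat \<Rightarrow> bool) \<times> (nat \<Rightarrow> bool)) set" where
  "triples n \<equiv> cube n \<times> cube n \<times> cube n"

lemma freq_triple1: "freq (triples n) (\<lambda>(x, y, z). P x) = freq (cube n) P"
  using freq_fst [of "cube n" "cube n \<times> cube n" P] by (simp add: case_prod_unfold)

lemma freq_triple2: "freq (triples n) (\<lambda>(x, y, z). P y) = freq (cube n) P"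
  using freq_snd [of "cube n" "cube n \<times> cube n" "\<lambda>(y, z). P y"]
  by (simp add: case_prod_unfold freq_fst [unfolded case_prod_unfold])

lemma freq_triple3: "freq (triples n) (\<lambda>(x, y, z). P z) = freq (cube n) P"
  using freq_snd [of "cube n" "cube n \<times> cube n" "\<lambda>(y, z). P z"]
  by (simp add: case_prod_unfold freq_snd [unfolded case_prod_unfold])

lemma freq_triple_sum:
  "freq (triples n) (\<lambda>(x, y, z). P (vadd n x (vadd n y z))) = freq (cube n) P"
proof -
  have "freq (triples n) (\<lambda>(x, y, z). P (vadd n x (vadd n y z)))
      = freq (cube n \<times> cube n) (\<lambda>(x, y). P y)"
  proof (rule freq_Times_cong_snd)
    fix x assume x: "x \<in> cube n"
    have "freq (cube n \<times> cube n) (\<lambda>(y, z). P (vadd n x (vadd n y z)))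
        = freq (cube n \<times> cube n) (\<lambda>(y, z). P z)"
      by (rule freq_Times_cong_snd) (simp_all add: x freq_vadd [of _ n "\<lambda>z. P (vadd n x z)"] freq_vadd)
    then show "freq (cube n \<times> cube n) (\<lambda>b. case (x, b) of (x, y, z) \<Rightarrow> P (vadd n x (vadd n y z)))
        = freq (cube n) (\<lambda>b. case (x, b) of (x, y) \<Rightarrow> P y)"
      by (simp add: freq_snd)
  qed simp_all
  then show ?thesis by (simp add: freq_snd)
qed

text \<open>For a fixed mask \<open>z\<close> the mixture of two independent uniform points is
  uniform.\<close>

lemma freq_triple_mix:
  "freq (triples n) (\<lambda>(x, y, z). P (mix n z y x)) = freq (cube n) P"
proof -
  let ?C = "cube n"
  have "bij_betw (\<lambda>(x, y, z). (z, y, x)) (?C \<times> ?C \<times> ?C) (?C \<times> ?C \<times> ?C)"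
    by (rule bij_betw_byWitness [of _ "\<lambda>(x, y, z). (z, y, x)"]) auto
  from freq_bij [OF this, of "\<lambda>(z, y, x). P (mix n z y x)"]
  have "freq (triples n) (\<lambda>(x, y, z). P (mix n z y x))
      = freq (triples n) (\<lambda>(z, y, x). P (mix n z y x))"
    by (simp add: case_prod_unfold)
  also have "\<dots> = freq (cube n \<times> cube n) (\<lambda>(z, y). P y)"
    by (rule freq_Times_cong_snd) (simp_all add: freq_mix)
  finally show ?thesis by (simp add: freq_snd)
qed

lemma freq_differ_self:
  assumes "finite A" "A \<noteq> {}"
  shows "freq (A \<times> A) (\<lambda>(x, y). D x \<noteq> D y) = 2 * freq A D * (1 - freq A D)"
proof -
  have "freq (A \<times> A) (\<lambda>(x, y). D x \<noteq> D y)
      = freq (A \<times> A) (\<lambda>(x, y). D x \<and> \<not> D y) + freq (A \<times> A) (\<lambda>(x, y). \<not> D x \<and> D y)"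
  proof -
    have "card {p \<in> A \<times> A. case p of (x, y) \<Rightarrow> D x \<noteq> D y}
        = card {p \<in> A \<times> A. case p of (x, y) \<Rightarrow> D x \<and> \<not> D y}
          + card {p \<in> A \<times> A. case p of (x, y) \<Rightarrow> \<not> D x \<and> D y}"
      using assms by (subst card_Un_disjoint [symmetric]) (auto intro!: arg_cong [of _ _ card])
    then show ?thesis by (simp add: freq_def add_divide_distrib)
  qed
  then show ?thesis by (simp add: freq_conj_Times assms freq_not algebra_simps)
qed

text \<open>The values of a derivative \<open>F x + F (a + x)\<close> agree for most pairs of points, so
  their majority value \<open>g a\<close> is almost always attained; hence \<open>g\<close> is exactly additive.\<close>

lemma affinity_test_majority:
  fixes n F
  defines "\<eta> \<equiv> freq (triples n) (\<lambda>(x, y, z). F (vadd n x (vadd n y z)) \<noteq> (F x \<noteq> (F y \<noteq> F z)))"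
  assumes \<eta>: "6 * \<eta> < 1"
  obtains g where
    "\<And>a. a \<in> cube n \<Longrightarrow> freq (cube n) (\<lambda>x. (F x \<noteq> F (vadd n a x)) \<noteq> g a) \<le> 2 * \<eta>"
    "\<And>a b. a \<in> cube n \<Longrightarrow> b \<in> cube n \<Longrightarrow> g (vadd n a b) = (g a \<noteq> g b)"
proof -
  let ?C = "cube n"
  define bad where "bad = (\<lambda>(x, y, z). F (vadd n x (vadd n y z)) \<noteq> (F x \<noteq> (F y \<noteq> F z)))"
  have bad: "freq (triples n) bad = \<eta>" by (simp add: \<eta>_def bad_def)
  define D where "D a x = (F x \<noteq> F (vadd n a x))" for a x
  define g where "g a = (freq ?C (D a) > 1/2)" for a
  have pair: "freq (?C \<times> ?C) (\<lambda>(x, y). D a x \<noteq> D a y) \<le> 2 * \<eta>" if a: "a \<in> ?C" for a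
  proof -
    \<comment> \<open>Translating \<open>x\<close> and \<open>y\<close> by \<open>a\<close> leaves x
      + y + z unchanged. If both triples pass, F x + F y and F (a + x) + F (a + y) both equal F z +
      F (x + y + z), so the derivatives at \<open>x\<close> and \<open>y\<close> agree.\<close>
    define \<phi> where "\<phi> = (\<lambda>(x, y, z :: nat \<Rightarrow> bool). (vadd n a x, vadd n a y, z))"
    have bij: "bij_betw \<phi> (triples n) (triples n)"
      by (rule bij_betw_byWitness [of _ \<phi>]) (auto simp: \<phi>_def vadd_cancel)
    have "freq (?C \<times> ?C) (\<lambda>(x, y). D a x \<noteq> D a y)
        = freq (triples n) (\<lambda>(x, y, z). D a x \<noteq> D a y)"
      by (rule freq_Times_cong_snd) (simp_all add: freq_fst)
    also have "\<dots> \<le> freq (triples n) (\<lambda>t. bad t \<or> bad (\<phi> t))"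
    proof (rule freq_mono)
      fix t assume t: "t \<in> triples n" and "case t of (x, y, z) \<Rightarrow> D a x \<noteq> D a y"
      then obtain x y z where xyz: "t = (x, y, z)" and D: "D a x \<noteq> D a y" by auto
      have "vadd n (vadd n a x) (vadd n (vadd n a y) z) = vadd n x (vadd n y z)"
        by (rule cube_eqI [of _ n]) (auto simp: vadd_apply)
      then show "bad t \<or> bad (\<phi> t)" using D by (auto simp: xyz bad_def \<phi>_def D_def)
    qed simp
    also have "\<dots> \<le> freq (triples n) bad + freq (triples n) (\<lambda>t. bad (\<phi> t))"
      by (rule freq_disj_le) simp
    finally show ?thesis by (simp add: freq_bij [OF bij] bad)
  qed
  have maj: "freq ?C (\<lambda>x. D a x \<noteq> g a) \<le> 2 * \<eta>" if a: "a \<in> ?C" for a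
  proof -
    \<comment> \<open>Two independent values of the derivative differ with probability 2 p (1 - p).
      The larger of p and 1 - p is at least 1/2, so the smaller is at most 2 p (1 - p).\<close>
    define p where "p = freq ?C (D a)"
    have p: "0 \<le> p" "p \<le> 1" by (simp_all add: p_def freq_nonneg freq_le_1)
    have *: "2 * p * (1 - p) \<le> 2 * \<eta>"
      using pair [OF a] unfolding freq_differ_self [OF finite_cube cube_nonempty] p_def .
    show ?thesis
    proof (cases "p > 1/2")
      case True
      have "freq ?C (\<lambda>x. D a x \<noteq> g a) = 1 - p"
        using True by (simp add: g_def p_def freq_not)
      moreover have "1 * (1 - p) \<le> 2 * p * (1 - p)" using True p by (intro mult_right_mono) auto
      ultimately show ?thesis using * by simp
    next
      case False
      have "freq ?C (\<lambda>x. D a x \<noteq> g a) = p"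
        using False by (simp add: g_def p_def)
      moreover have "p * 1 \<le> p * (2 * (1 - p))" using False p by (intro mult_left_mono) auto
      ultimately show ?thesis using * by (simp add: algebra_simps)
    qed
  qed
  have lin: "g (vadd n a b) = (g a \<noteq> g b)" if a: "a \<in> ?C" and b: "b \<in> ?C" for a b
  proof -
    \<comment> \<open>The three exceptional sets have total frequency at most 6 \<eta> < 1. At a
      point outside them the identity D (a + b) x = D a x + D b (a + x) passes to the majority
      values.\<close>
    let ?P = "\<lambda>x. D a x \<noteq> g a" and ?Q = "\<lambda>x. D b (vadd n a x) \<noteq> g b"
      and ?R = "\<lambda>x. D (vadd n a b) x \<noteq> g (vadd n a b)"
    have "freq ?C (\<lambda>x. \<not> \<not> (?P x \<or> ?Q x \<or> ?R x)) \<le> freq ?C ?P + (freq ?C ?Q + freq ?C ?R)"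
      using freq_disj_le [of ?C ?P "\<lambda>x. ?Q x \<or> ?R x"] freq_disj_le [of ?C ?Q ?R] by simp
    also have "freq ?C ?Q = freq ?C (\<lambda>x. D b x \<noteq> g b)" by (rule freq_vadd [OF a])
    finally have "freq ?C (\<lambda>x. \<not> \<not> (?P x \<or> ?Q x \<or> ?R x)) < 1"
      using maj [OF a] maj [OF b] maj [of "vadd n a b"] \<eta> by simp
    then obtain x where "\<not> (?P x \<or> ?Q x \<or> ?R x)"
      using freq_less_1_ex [OF finite_cube cube_nonempty, of n "\<lambda>x. \<not> (?P x \<or> ?Q x \<or> ?R x)"]
      by blast
    moreover have "vadd n (vadd n a b) x = vadd n b (vadd n a x)"
      by (rule cube_eqI [of _ n]) (auto simp: vadd_apply)
    ultimately show ?thesis by (auto simp: D_def)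
  qed
  show thesis using that [of g] maj lin by (auto simp: D_def)
qed

text \<open>An additive map is determined by its values on unit vectors, by induction over the
  support; \<open>S\<close> collects the coordinates whose unit vector is mapped to True.\<close>

lemma additive_is_parity:
  assumes "\<And>a b. a \<in> cube n \<Longrightarrow> b \<in> cube n \<Longrightarrow> g (vadd n a b) = (g a \<noteq> g b)"
  shows "\<exists>S\<subseteq>{..<n}. \<forall>x\<in>cube n. g x = odd (card {i \<in> S. x i})"
proof -
  define ind where "ind T = (\<lambda>j\<in>{..<n}. j \<in> T)" for T
  have ind: "ind T \<in> cube n" for T by (simp add: ind_def cube_def)
  define S where "S = {i. i < n \<and> g (ind {i})}"
  have g_ind: "g (ind T) = odd (card (T \<inter> S))" if "T \<subseteq> {..<n}" for T
    using finite_subset [OF that finite_lessThan] that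
  proof (induction T rule: finite_induct)
    case empty
    have "vadd n (ind {}) (ind {}) = ind {}"
      by (rule cube_eqI [of _ n]) (simp_all add: vadd_apply ind, simp add: ind_def)
    then show ?case using assms [OF ind ind, of "{}" "{}"] by simp
  next
    case (insert i T)
    have "ind (insert i T) = vadd n (ind {i}) (ind T)"
      using insert by (intro cube_eqI [of _ n] ind) (auto simp: vadd_apply ind_def)
    then have "g (ind (insert i T)) = (g (ind {i}) \<noteq> g (ind T))" by (simp add: assms ind)
    also have "\<dots> = ((i \<in> S) \<noteq> odd (card (T \<inter> S)))" using insert by (simp add: S_def)
    also have "\<dots> = odd (card (insert i T \<inter> S))" using insert by (simp add: Int_insert_left)
    finally show ?case .
  qed
  have "g x = odd (card {i \<in> S. x i})" if x: "x \<in> cube n" for x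
  proof -
    have "x = ind {i \<in> {..<n}. x i}"
      by (rule cube_eqI [OF x ind]) (simp add: ind_def)
    then have "g x = g (ind {i \<in> {..<n}. x i})" by simp
    also have "\<dots> = odd (card ({i \<in> {..<n}. x i} \<inter> S))" by (rule g_ind) auto
    also have "{i \<in> {..<n}. x i} \<inter> S = {i \<in> S. x i}" by (auto simp: S_def)
    finally show ?thesis .
  qed
  then show ?thesis by (intro exI [of _ S]) (auto simp: S_def)
qed

lemma affinity_test:
  assumes "freq (triples n) (\<lambda>(x, y, z). F (vadd n x (vadd n y z)) \<noteq> (F x \<noteq> (F y \<noteq> F z))) \<le> \<eta>"
    and "6 * \<eta> < 1"
  obtains S c where "S \<subseteq> {..<n}" "freq (cube n) (\<lambda>x. F x \<noteq> (odd (card {i \<in> S. x i}) \<noteq> c)) \<le> 2 * \<eta>"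
proof -
  let ?C = "cube n"
  have small: "6 * freq (triples n)
      (\<lambda>(x, y, z). F (vadd n x (vadd n y z)) \<noteq> (F x \<noteq> (F y \<noteq> F z))) < 1"
    using assms by linarith
  obtain g where maj': "\<And>a. a \<in> ?C \<Longrightarrow> freq ?C (\<lambda>x. (F x \<noteq> F (vadd n a x)) \<noteq> g a)
      \<le> 2 * freq (triples n) (\<lambda>(x, y, z). F (vadd n x (vadd n y z)) \<noteq> (F x \<noteq> (F y \<noteq> F z)))"
    and lin: "\<And>a b. a \<in> ?C \<Longrightarrow> b \<in> ?C \<Longrightarrow> g (vadd n a b) = (g a \<noteq> g b)"
    using affinity_test_majority [OF small] by blast
  have maj: "freq ?C (\<lambda>x. (F x \<noteq> F (vadd n a x)) \<noteq> g a) \<le> 2 * \<eta>" if "a \<in> ?C" for a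
    using maj' [OF that] assms(1) by linarith
  have eta: "0 \<le> \<eta>" using assms(1) freq_nonneg order_trans by blast
  obtain S where S: "S \<subseteq> {..<n}" "\<And>x. x \<in> ?C \<Longrightarrow> g x = odd (card {i \<in> S. x i})"
    using additive_is_parity [OF lin] by blast
  have "freq (?C \<times> ?C) (\<lambda>(a, x). (F x \<noteq> F (vadd n a x)) \<noteq> g a) \<le> 2 * \<eta>"
    by (rule freq_Times_le) (use maj eta in auto)
  then have "freq (?C \<times> ?C) (\<lambda>(x, a). (F x \<noteq> F (vadd n a x)) \<noteq> g a) \<le> 2 * \<eta>"
    by (subst freq_swap)
  \<comment> \<open>Averaging fixes a base point \<open>x\<close> with F (a + x) = F x + g a for
    most \<open>a\<close>. Substituting a = x + y gives F y = g y + (F x + g x), which identifies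
    the additive constant.\<close>
  from freq_Times_ex [OF _ _ _ this]
  obtain x where x: "x \<in> ?C" and ax: "freq ?C (\<lambda>a. (F x \<noteq> F (vadd n a x)) \<noteq> g a) \<le> 2 * \<eta>"
    by auto
  have "freq ?C (\<lambda>y. F y \<noteq> (odd (card {i \<in> S. y i}) \<noteq> (F x \<noteq> g x)))
      = freq ?C (\<lambda>a. (F x \<noteq> F (vadd n (vadd n x a) x)) \<noteq> g (vadd n x a))"
  proof (rule freq_cong)
    fix y assume y: "y \<in> ?C"
    have "vadd n (vadd n x y) x = y"
      using vadd_cancel [OF y, of x] by (metis vadd_commute)
    then show "(F y \<noteq> (odd (card {i \<in> S. y i}) \<noteq> (F x \<noteq> g x)))
        = ((F x \<noteq> F (vadd n (vadd n x y) x)) \<noteq> g (vadd n x y))"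
      using lin [OF x y] S(2) [OF y] by auto
  qed
  also have "\<dots> \<le> 2 * \<eta>"
    unfolding freq_vadd [OF x, of "\<lambda>a. (F x \<noteq> F (vadd n a x)) \<noteq> g a"] by (rule ax)
  finally show thesis by (rule that [OF S(1)])
qed

section \<open>The mask test against parities of two or more variables\<close>

definition tog :: "bool \<Rightarrow> nat \<Rightarrow> (nat \<Rightarrow> bool) \<Rightarrow> nat \<Rightarrow> bool" where
  "tog b i x = x(i := (x i \<noteq> b))"

lemma tog_cube [simp]: "i < n \<Longrightarrow> x \<in> cube n \<Longrightarrow> tog b i x \<in> cube n"
  by (auto simp: tog_def cube_def PiE_iff extensional_def)

lemma tog_tog: "tog b i (tog b i x) = x"
  by (rule ext) (auto simp: tog_def)

lemma tog_commute: "tog b i (tog b' k x) = tog b' k (tog b i x)"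
  by (rule ext) (auto simp: tog_def)

lemma parity_tog:
  assumes "finite S" "i \<in> S"
  shows "odd (card {j \<in> S. tog b i x j}) = (odd (card {j \<in> S. x j}) \<noteq> b)"
proof (cases b)
  case True
  let ?R = "{j \<in> S - {i}. x j}"
  have "{j \<in> S. tog b i x j} = (if x i then ?R else insert i ?R)"
    "{j \<in> S. x j} = (if x i then insert i ?R else ?R)"
    using assms True by (auto simp: tog_def)
  moreover have "finite ?R" "i \<notin> ?R" using assms by auto
  ultimately show ?thesis using True by (simp only: if_distrib [of card] card_insert_disjoint) auto
next
  case False
  then show ?thesis by (simp add: tog_def)
qed

text \<open>Toggle the mask \<open>z\<close> so that it takes coordinate \<open>i\<close> from \<open>x\<close> and \<open>k\<close> from \<open>y\<close>. Then
  toggling \<open>x k\<close> or \<open>y i\<close> flips the parity of \<open>x\<close> or \<open>y\<close> but leaves the mixture alone.\<close>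

lemma mask_test_rejects_parity:
  fixes n i k S c
  assumes S: "finite S" "i \<in> S" "k \<in> S" "i \<noteq> k" and n: "i < n" "k < n"
  defines "L \<equiv> \<lambda>x. odd (card {j \<in> S. x j}) \<noteq> c"
  shows "1 / 16 \<le> freq (triples n) (\<lambda>(x, y, z). L x = L y \<and> L (mix n z y x) \<noteq> L x)"
proof -
  \<comment> \<open>Four bits say which toggles of the mask at \<open>i\<close> and
    \<open>k\<close>, of \<open>x\<close> at \<open>k\<close> and of \<open>y\<close> at
    \<open>i\<close> are carried out. Each of the 16 choices is an involution, whence the bound
    1/16.\<close>
  define \<phi> where "\<phi> = (\<lambda>(p, q, v, w) (x, y, z). (tog v k x, tog w i y, tog p i (tog q k z)))"
  let ?P = "\<lambda>(x, y, z). L x = L y \<and> L (mix n z y x) \<noteq> L x"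
  have L_tog: "L (tog b j x) = (L x \<noteq> b)" if "j \<in> S" for b j x
    using parity_tog [OF S(1) that, of b x] by (auto simp: L_def)
  have "1 / real (card (UNIV :: (bool \<times> bool \<times> bool \<times> bool) set)) \<le> freq (triples n) ?P"
  proof (rule freq_ge_if_bijections_cover)
    fix t :: "bool \<times> bool \<times> bool \<times> bool"
    obtain p q v w where "t = (p, q, v, w)" by (metis prod_cases4)
    then show "bij_betw (\<phi> t) (triples n) (triples n)"
      by (intro bij_betw_byWitness [of _ "\<phi> t"])
        (use n in \<open>auto simp: \<phi>_def tog_tog tog_commute [of _ k _ i]\<close>)
  next
    fix a assume "a \<in> triples n"
    then obtain x y z where a: "a = (x, y, z)" "x \<in> cube n" "y \<in> cube n" "z \<in> cube n" by auto
    define z' where "z' = tog (\<not> z i) i (tog (z k) k z)"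
    have z': "z' i" "\<not> z' k" using S by (auto simp: z'_def tog_def)
    \<comment> \<open>\<open>v\<close> makes the parity of \<open>x\<close> differ from that of the
      mixture; \<open>w\<close> then makes the parity of \<open>y\<close> equal to that of the
      toggled \<open>x\<close>.\<close>
    define v where "v = (L (mix n z' y x) = L x)"
    define w where "w = (L y \<noteq> (L x \<noteq> v))"
    have "mix n z' (tog w i y) (tog v k x) = mix n z' y x"
      using z' by (auto simp: mix_def tog_def fun_eq_iff)
    then have "?P (\<phi> (\<not> z i, z k, v, w) a)"
      using S by (auto simp: a \<phi>_def L_tog v_def w_def simp flip: z'_def)
    then show "\<exists>t\<in>UNIV. ?P (\<phi> t a)" by (rule bexI) simp
  qed auto
  then show ?thesis by simp
qed

text \<open>The first condition alone would accept every parity. If \<open>F\<close> reads only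
  coordinate \<open>i\<close>, the mixture copies this coordinate from \<open>x\<close> or from
  \<open>y\<close>, so its value is \<open>F x\<close> or \<open>F y\<close>; the second condition
  asks only when these coincide.\<close>

fun unary_test :: "nat \<Rightarrow> ((nat \<Rightarrow> bool) \<Rightarrow> bool)
    \<Rightarrow> (nat \<Rightarrow> bool) \<times> (nat \<Rightarrow> bool) \<times> (nat \<Rightarrow> bool) \<Rightarrow> bool" where
  "unary_test n F (x, y, z) \<longleftrightarrow>
    F (vadd n x (vadd n y z)) = (F x \<noteq> (F y \<noteq> F z)) \<and>
    (F x = F y \<longrightarrow> F (mix n z y x) = F x)"

lemma unary_test_complete:
  assumes "i < n" "\<And>x. x \<in> cube n \<Longrightarrow> F x = \<phi> (x i)" "t \<in> triples n"
  shows "unary_test n F t"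
proof -
  obtain x y z where t: "t = (x, y, z)" "x \<in> cube n" "y \<in> cube n" "z \<in> cube n"
    using assms(3) by auto
  show ?thesis
    using assms(1) t
    by (cases "x i"; cases "y i"; cases "z i"; cases "\<phi> True"; cases "\<phi> False")
      (auto simp: assms(2) vadd_apply mix_apply)
qed

text \<open>The first condition makes \<open>F\<close> close to an affine function \<open>L\<close>.
  If \<open>L\<close> had two relevant variables, it would violate the second condition with
  probability 1/16, while \<open>F\<close> and \<open>L\<close> disagree on one of the three uniform
  points involved with probability at most 6 \<eta>. Then 1/16 \<le> 7 \<eta>, which the bound 1/200
  excludes.\<close>

lemma unary_test_sound:
  assumes rej: "freq (triples n) (\<lambda>t. \<not> unary_test n F t) \<le> \<eta>" and \<eta>: "\<eta> \<le> 1 / 200" and n: "0 < n"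
  obtains i \<phi> where "i < n" "freq (cube n) (\<lambda>x. F x \<noteq> \<phi> (x i)) \<le> 2 * \<eta>"
proof -
  let ?C = "cube n"
  have eta: "0 \<le> \<eta>" using rej freq_nonneg order_trans by blast
  have "freq (triples n) (\<lambda>(x, y, z). F (vadd n x (vadd n y z)) \<noteq> (F x \<noteq> (F y \<noteq> F z)))
      \<le> freq (triples n) (\<lambda>t. \<not> unary_test n F t)"
    by (rule freq_mono) auto
  then have "freq (triples n) (\<lambda>(x, y, z). F (vadd n x (vadd n y z)) \<noteq> (F x \<noteq> (F y \<noteq> F z))) \<le> \<eta>"
    using rej by linarith
  moreover have "6 * \<eta> < 1" using \<eta> by simp
  ultimately obtain S c where S: "S \<subseteq> {..<n}"
    and close: "freq ?C (\<lambda>x. F x \<noteq> (odd (card {i \<in> S. x i}) \<noteq> c)) \<le> 2 * \<eta>"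
    by (rule affinity_test)
  define L where "L x = (odd (card {i \<in> S. x i}) \<noteq> c)" for x
  have closeL: "freq ?C (\<lambda>x. F x \<noteq> L x) \<le> 2 * \<eta>" using close by (simp add: L_def)
  have finS: "finite S" using S finite_subset by blast
  have "i = k" if ik: "i \<in> S" "k \<in> S" for i k
  proof (rule ccontr)
    assume "i \<noteq> k"
    have "i < n" "k < n" using ik S by auto
    let ?A = "\<lambda>(x, y, z). F x \<noteq> L x" and ?B = "\<lambda>(x, y, z). F y \<noteq> L y"
      and ?D = "\<lambda>(x, y, z). F (mix n z y x) \<noteq> L (mix n z y x)"
    have "1 / 16 \<le> freq (triples n) (\<lambda>(x, y, z). L x = L y \<and> L (mix n z y x) \<noteq> L x)"
      unfolding L_def
      by (rule mask_test_rejects_parity [OF finS ik \<open>i \<noteq> k\<close> \<open>i < n\<close> \<open>k < n\<close>])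
    also have "\<dots> \<le> freq (triples n) (\<lambda>t. \<not> unary_test n F t \<or> ?A t \<or> ?B t \<or> ?D t)"
      by (rule freq_mono) auto
    also have "\<dots> \<le> freq (triples n) (\<lambda>t. \<not> unary_test n F t)
        + (freq (triples n) ?A + (freq (triples n) ?B + freq (triples n) ?D))"
      using freq_disj_le [of "triples n" "\<lambda>t. \<not> unary_test n F t" "\<lambda>t. ?A t \<or> ?B t \<or> ?D t"]
        freq_disj_le [of "triples n" ?A "\<lambda>t. ?B t \<or> ?D t"] freq_disj_le [of "triples n" ?B ?D]
      by simp
    also have "\<dots> \<le> \<eta> + (2 * \<eta> + (2 * \<eta> + 2 * \<eta>))"
      using rej closeL freq_triple1 [of n "\<lambda>x. F x \<noteq> L x"] freq_triple2 [of n "\<lambda>x. F x \<noteq> L x"]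
        freq_triple_mix [of n "\<lambda>x. F x \<noteq> L x"]
      by linarith
    finally show False using \<eta> by simp
  qed
  then consider "S = {}" | i where "S = {i}" by blast
  then show thesis
  proof cases
    case 1
    then show thesis using that [of 0 "\<lambda>_. c"] n close by simp
  next
    case (2 i)
    have "{j. j = i \<and> x j} = (if x i then {i} else {})" for x :: "nat \<Rightarrow> bool" by auto
    then have "L x = (x i \<noteq> c)" for x by (simp add: L_def 2)
    then show thesis using that [of i "\<lambda>b. b \<noteq> c"] 2 S closeL by simp
  qed
qed

section \<open>Decision lists with a default value\<close>

text \<open>Truncating lists and deleting tests leaves points on which no entry fires; a default
  value keeps such lists total. Appending two complementary tests of one variable turns them back
  into decision lists.\<close>

fun dl_default :: "decision_list \<Rightarrow> bool \<Rightarrow> (nat \<Rightarrow> bool) \<Rightarrow> bool" where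
  "dl_default [] d x = d"
| "dl_default ((i, \<xi>, a) # L) d x = (if x i = \<xi> then a else dl_default L d x)"

lemma dl_eval_imp_dl_default: "dl_eval L x = Some b \<Longrightarrow> dl_default L d x = b"
  by (induction L x rule: dl_eval.induct) (auto split: if_splits)

lemma dl_eval_append_default:
  "dl_eval (L @ [(i, False, d), (i, True, d)]) x = Some (dl_default L d x)"
  by (induction L d x rule: dl_default.induct) auto

lemma dl_default_in_Decision_List:
  assumes "0 < n" "fst ` set L \<subseteq> {..<n}"
  shows "dl_default L d \<in> Decision_List n"
  unfolding Decision_List_def using assms(1) subsetD [OF assms(2)]
  by (force simp: dl_eval_append_default intro!: exI [of _ "L @ [(0, False, d), (0, True, d)]"])

lemma dl_default_cong:
  "(\<And>i. i \<in> fst ` set L \<Longrightarrow> x i = y i) \<Longrightarrow> dl_default L d x = dl_default L d y"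
  by (induction L d x rule: dl_default.induct) auto

text \<open>A test of \<open>\<phi> j (x (\<iota> j))\<close> against \<xi> expands into one test
  for each value of the variable that \<open>\<phi> j\<close> sends to \<xi>: none, one or
  two.\<close>

lemma dl_default_subst_unary:
  assumes "fst ` set H \<subseteq> {..<r}" "\<And>j. j < r \<Longrightarrow> \<iota> j < n"
  shows "\<exists>L. fst ` set L \<subseteq> {..<n} \<and>
    (\<forall>x. dl_default L d x = dl_default H d (\<lambda>j. \<phi> j (x (\<iota> j))))"
  using assms(1)
proof (induction H)
  case Nil
  show ?case by (intro exI [of _ "[]"]) simp
next
  case (Cons e H)
  obtain j \<xi> a where e: "e = (j, \<xi>, a)" by (cases e)
  obtain L where L: "fst ` set L \<subseteq> {..<n}"
    "\<And>x. dl_default L d x = dl_default H d (\<lambda>j. \<phi> j (x (\<iota> j)))"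
    using Cons by auto
  let ?L = "(if \<phi> j False = \<xi> then [(\<iota> j, False, a)] else []) @
    (if \<phi> j True = \<xi> then [(\<iota> j, True, a)] else []) @ L"
  have "dl_default ?L d x = dl_default (e # H) d (\<lambda>j. \<phi> j (x (\<iota> j)))" for x
    by (cases "x (\<iota> j)") (auto simp: e L(2))
  moreover have "fst ` set ?L \<subseteq> {..<n}" using L(1) Cons.prems assms(2) by (auto simp: e)
  ultimately show ?case by (intro exI [of _ ?L]) blast
qed

text \<open>A found variable is replaced by its block value, up to negation. Any other has the fixed
  value given by \<open>z\<close>, so its test either never fires and is dropped, or always fires
  and ends the list as the new default.\<close>

lemma dl_default_read_off:
  assumes "\<And>i. i \<in> fst ` set M \<Longrightarrow> \<pi> i < r"
    and "\<And>i. i \<in> fst ` set M \<Longrightarrow> found i \<Longrightarrow> \<exists>c. \<forall>x\<in>X. b (\<pi> i) x = (x i \<noteq> c)"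
  shows "\<exists>H d'. length H \<le> length M \<and> fst ` set H \<subseteq> {..<r} \<and>
    (\<forall>x\<in>X. dl_default H d' (\<lambda>j. b j x) = dl_default M d (\<lambda>i. if found i then x i else z i))"
  using assms
proof (induction M)
  case Nil
  show ?case by (intro exI [of _ "[]"] exI [of _ d]) simp
next
  case (Cons e M)
  obtain i \<xi> a where e: "e = (i, \<xi>, a)" by (cases e)
  have "\<exists>H d'. length H \<le> length M \<and> fst ` set H \<subseteq> {..<r} \<and>
    (\<forall>x\<in>X. dl_default H d' (\<lambda>j. b j x) = dl_default M d (\<lambda>i. if found i then x i else z i))"
    by (rule Cons.IH) (use Cons.prems in auto)
  then obtain H d' where H: "length H \<le> length M" "fst ` set H \<subseteq> {..<r}"
    "\<And>x. x \<in> X \<Longrightarrow> dl_default H d' (\<lambda>j. b j x) = dl_default M d (\<lambda>i. if found i then x i else z i)"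
    by blast
  consider "found i" | "\<not> found i" "z i = \<xi>" | "\<not> found i" "z i \<noteq> \<xi>" by blast
  then show ?case
  proof cases
    case 1
    then obtain c where "\<forall>x\<in>X. b (\<pi> i) x = (x i \<noteq> c)" using Cons.prems(2) by (auto simp: e)
    then show ?thesis using H 1 Cons.prems(1) [of i]
      by (intro exI [of _ "(\<pi> i, \<xi> \<noteq> c, a) # H"] exI [of _ d']) (auto simp: e)
  next
    case 2
    then show ?thesis by (intro exI [of _ "[]"] exI [of _ a]) (simp add: e)
  next
    case 3
    then show ?thesis using H by (intro exI [of _ H] exI [of _ d']) (auto simp: e)
  qed
qed

text \<open>\<open>\<rho>\<close> records the values forced by the failure of earlier tests. A test
  of a variable in its domain is already decided: it is dropped, or it always fires and its output
  becomes the default.\<close>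

lemma dl_default_distinct:
  "\<exists>M d'. distinct (map fst M) \<and> fst ` set M \<subseteq> fst ` set L - dom \<rho> \<and>
    (\<forall>x. (\<forall>i v. \<rho> i = Some v \<longrightarrow> x i = v) \<longrightarrow> dl_default M d' x = dl_default L d x)"
proof (induction L arbitrary: \<rho>)
  case Nil
  show ?case by (intro exI [of _ "[]"] exI [of _ d]) simp
next
  case (Cons e L)
  obtain i \<xi> a where e: "e = (i, \<xi>, a)" by (cases e)
  show ?case
  proof (cases "\<rho> i")
    case None
    obtain M d' where M: "distinct (map fst M)" "fst ` set M \<subseteq> fst ` set L - dom (\<rho>(i \<mapsto> \<not> \<xi>))"
      "\<And>x. (\<forall>j v. (\<rho>(i \<mapsto> \<not> \<xi>)) j = Some v \<longrightarrow> x j = v) \<Longrightarrow> dl_default M d' x = dl_default L d x"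
      using Cons.IH [of "\<rho>(i \<mapsto> \<not> \<xi>)"] by blast
    have "dl_default ((i, \<xi>, a) # M) d' x = dl_default (e # L) d x"
      if "\<forall>j v. \<rho> j = Some v \<longrightarrow> x j = v" for x
      using M(3) [of x] that by (auto simp: e)
    then show ?thesis using M(1,2) None
      by (intro exI [of _ "(i, \<xi>, a) # M"] exI [of _ d']) (auto simp: e)
  next
    case (Some v)
    show ?thesis
    proof (cases "v = \<xi>")
      case True
      then show ?thesis using Some by (intro exI [of _ "[]"] exI [of _ a]) (auto simp: e)
    next
      case False
      obtain M d' where M: "distinct (map fst M)" "fst ` set M \<subseteq> fst ` set L - dom \<rho>"
        "\<And>x. (\<forall>j v. \<rho> j = Some v \<longrightarrow> x j = v) \<Longrightarrow> dl_default M d' x = dl_default L d x"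
        using Cons.IH [of \<rho>] by blast
      show ?thesis
        by (intro exI [of _ M] exI [of _ d']) (use M Some False in \<open>auto simp: e\<close>)
    qed
  qed
qed

lemma dl_default_take:
  "(\<exists>(i, \<xi>, a) \<in> set (take k M). x i = \<xi>) \<Longrightarrow> dl_default (take k M) d x = dl_default M d x"
proof (induction M arbitrary: k)
  case (Cons e M)
  then show ?case by (cases k; cases e) auto
qed simp

lemma freq_fall_through:
  assumes "distinct (map fst M)" "fst ` set M \<subseteq> {..<n}"
  shows "freq (cube n) (\<lambda>x. \<forall>(i, \<xi>, a) \<in> set M. x i \<noteq> \<xi>) \<le> 1 / 2 ^ length M"
proof -
  have "freq (cube n) (\<lambda>x. \<forall>(i, \<xi>, a) \<in> set M. x i \<noteq> \<xi>)
      \<le> freq (cube n) (\<lambda>x. \<forall>i\<in>{..<n}. case map_of M i of None \<Rightarrow> True | Some (\<xi>, a) \<Rightarrow> x i \<noteq> \<xi>)"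
    by (rule freq_mono) (auto split: option.splits dest: map_of_SomeD)
  also have "\<dots> = (\<Prod>i\<in>{..<n}. freq UNIV (\<lambda>b. case map_of M i of None \<Rightarrow> True | Some (\<xi>, a) \<Rightarrow> b \<noteq> \<xi>))"
    unfolding cube_def by (rule freq_PiE) simp
  also have "\<dots> = (\<Prod>i\<in>fst ` set M. 1 / 2)"
  proof (intro prod.mono_neutral_cong_right ballI)
    fix i assume "i \<in> fst ` set M"
    then obtain \<xi> a where "map_of M i = Some (\<xi>, a)"
      by (metis map_of_eq_None_iff option.exhaust surj_pair)
    moreover have "{b. b \<noteq> \<xi>} = {\<not> \<xi>}" by auto
    ultimately show "freq UNIV (\<lambda>b. case map_of M i of None \<Rightarrow> True | Some (\<xi>, a) \<Rightarrow> b \<noteq> \<xi>) = 1 / 2"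
      by (simp add: freq_def)
  next
    fix i assume "i \<in> {..<n} - fst ` set M"
    then have "map_of M i = None" by (simp add: map_of_eq_None_iff)
    then show "freq UNIV (\<lambda>b. case map_of M i of None \<Rightarrow> True | Some (\<xi>, a) \<Rightarrow> b \<noteq> \<xi>) = 1"
      by (simp add: freq_True)
  qed (use assms in auto)
  also have "\<dots> = 1 / 2 ^ length M"
    using distinct_card [OF assms(1)] by (simp add: power_divide)
  finally show ?thesis .
qed

text \<open>Once repeated variables are removed, the first \<open>k\<close> tests are independent.
  They all fail on a fraction of at most 2 ^ -k of the points, and only there can the truncation
  differ from \<open>f\<close>.\<close>

lemma Decision_List_truncate:
  assumes "f \<in> Decision_List n"
  obtains M d where "length M \<le> k" "fst ` set M \<subseteq> {..<n}"
    "freq (cube n) (\<lambda>x. f x \<noteq> dl_default M d x) \<le> 1 / 2 ^ k"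
proof -
  obtain L where L: "\<forall>(i, \<xi>, a) \<in> set L. i < n" "\<And>x. x \<in> cube n \<Longrightarrow> dl_eval L x = Some (f x)"
    using assms unfolding Decision_List_def by blast
  obtain M d where M: "distinct (map fst M)" "fst ` set M \<subseteq> fst ` set L"
    "\<And>x. dl_default M d x = dl_default L True x"
    using dl_default_distinct [where \<rho> = Map.empty and L = L and d = True] by auto
  have eq: "f x = dl_default M d x" if "x \<in> cube n" for x
    using dl_eval_imp_dl_default [OF L(2) [OF that], of True] by (simp add: M(3))
  have vars: "fst ` set M \<subseteq> {..<n}" using M(2) L(1) by fastforce
  show thesis
  proof (cases "length M \<le> k")
    case True
    have "freq (cube n) (\<lambda>x. f x \<noteq> dl_default M d x) = freq (cube n) (\<lambda>_. False)"
      by (rule freq_cong) (simp add: eq)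
    then show thesis using that [of M d] True vars by (simp add: freq_False)
  next
    case False
    have "freq (cube n) (\<lambda>x. f x \<noteq> dl_default (take k M) d x)
        \<le> freq (cube n) (\<lambda>x. \<forall>(i, \<xi>, a) \<in> set (take k M). x i \<noteq> \<xi>)"
    proof (rule freq_mono)
      fix x assume "x \<in> cube n" "f x \<noteq> dl_default (take k M) d x"
      then have "\<not> (\<exists>(i, \<xi>, a) \<in> set (take k M). x i = \<xi>)"
        using dl_default_take [of k M x d] eq by auto
      then show "\<forall>(i, \<xi>, a) \<in> set (take k M). x i \<noteq> \<xi>" by blast
    qed simp
    also have "\<dots> \<le> 1 / 2 ^ length (take k M)"
    proof (rule freq_fall_through)
      show "distinct (map fst (take k M))" using M(1) by (simp flip: take_map)
      show "fst ` set (take k M) \<subseteq> {..<n}" using vars set_take_subset [of k M] by blast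
    qed
    finally show thesis
      using that [of "take k M" d] False vars set_take_subset [of k M] by auto
  qed
qed

lemma card_decision_lists:
  fixes k r
  defines "\<H> \<equiv> {H :: decision_list. length H \<le> k \<and> fst ` set H \<subseteq> {..<r}}"
  shows "finite \<H>" "card \<H> \<le> (4 * r + 1) ^ k"
proof -
  let ?A = "{..<r} \<times> (UNIV :: (bool \<times> bool) set)"
  have eq: "\<H> = {H. set H \<subseteq> ?A \<and> length H \<le> k}" by (force simp: \<H>_def)
  have A: "finite ?A" "card ?A = 4 * r"
    by (simp_all add: card_cartesian_product flip: UNIV_Times_UNIV)
  show "finite \<H>" unfolding eq by (rule finite_lists_length_le [OF A(1)])
  have "(\<Sum>i\<le>k. (4 * r) ^ i) \<le> (\<Sum>i\<le>k. (k choose i) * (4 * r) ^ i)"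
    by (intro sum_mono) (simp add: Suc_leI)
  also have "\<dots> = (4 * r + 1) ^ k"
    using binomial [of "4 * r" 1 k] by simp
  finally show "card \<H> \<le> (4 * r + 1) ^ k"
    unfolding eq by (simp add: card_lists_length_le [OF A(1)] A(2))
qed

section \<open>Building oracle algorithms\<close>

primrec ask :: "'x list \<Rightarrow> ('x set \<Rightarrow> 'x oracle_alg) \<Rightarrow> 'x oracle_alg" where
  "ask [] K = K {}"
| "ask (q # qs) K = Query q (\<lambda>b. ask qs (\<lambda>T. K (if b then insert q T else T)))"

lemma run_ask: "run (ask qs K) f = run (K {q \<in> set qs. f q}) f"
proof (induction qs arbitrary: K)
  case (Cons q qs)
  have "(if f q then insert q {x \<in> set qs. f x} else {x \<in> set qs. f x}) = {x \<in> set (q # qs). f x}"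
    by auto
  then show ?case by (simp only: ask.simps run.simps Cons.IH)
qed simp

lemma num_queries_ask: "(\<And>T. num_queries (K T) \<le> b) \<Longrightarrow> num_queries (ask qs K) \<le> length qs + b"
  by (induction qs arbitrary: K) auto

lemma query_points_ask:
  "set qs \<subseteq> D \<Longrightarrow> (\<And>T. query_points (K T) \<subseteq> D) \<Longrightarrow> query_points (ask qs K) \<subseteq> D"
  by (induction qs arbitrary: K) (auto simp: UN_subset_iff)

text \<open>The congruence hypotheses say that \<open>Q2\<close> and \<open>dec\<close> see
  \<open>g\<close> only through the answers. Hence both can be evaluated on the characteristic
  function of the points answered True so far, which agrees with the oracle wherever it
  matters.\<close>

lemma two_round_algorithm:
  fixes Q2 :: "('x \<Rightarrow> bool) \<Rightarrow> 'x set"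
  assumes Q1: "finite Q1" "Q1 \<subseteq> D" "card Q1 \<le> a"
    and Q2: "\<And>g. finite (Q2 g)" "\<And>g. Q2 g \<subseteq> D" "\<And>g. card (Q2 g) \<le> b"
    and Q2_cong: "\<And>g h. (\<And>x. x \<in> Q1 \<Longrightarrow> g x = h x) \<Longrightarrow> Q2 g = Q2 h"
    and dec_cong: "\<And>g h. (\<And>x. x \<in> Q1 \<union> Q2 g \<Longrightarrow> g x = h x) \<Longrightarrow> dec g = dec h"
  obtains A where "query_points A \<subseteq> D" "num_queries A \<le> a + b" "\<And>f. run A f = return_pmf (dec f)"
proof -
  obtain qs1 where qs1: "set qs1 = Q1" "length qs1 = card Q1"
    using finite_distinct_list [OF Q1(1)] distinct_card by metis
  have "\<forall>g. \<exists>qs. set qs = Q2 g \<and> length qs = card (Q2 g)"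
    using finite_distinct_list [OF Q2(1)] distinct_card by metis
  then obtain qs2 where qs2: "\<And>g. set (qs2 g) = Q2 g" "\<And>g. length (qs2 g) = card (Q2 g)"
    by metis
  let ?K = "\<lambda>T1. ask (qs2 (\<lambda>x. x \<in> T1)) (\<lambda>T2. Return (dec (\<lambda>x. x \<in> T1 \<union> T2)))"
  show thesis
  proof (rule that [of "ask qs1 ?K"])
    show "query_points (ask qs1 ?K) \<subseteq> D"
      using Q1 Q2 by (intro query_points_ask) (auto simp: qs1 qs2)
    have "num_queries (?K T1) \<le> b" for T1
    proof -
      have "num_queries (?K T1) \<le> length (qs2 (\<lambda>x. x \<in> T1)) + 0"
        by (rule num_queries_ask) simp
      then show ?thesis using Q2(3) [of "\<lambda>x. x \<in> T1"] by (simp add: qs2)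
    qed
    then have "num_queries (ask qs1 ?K) \<le> length qs1 + b" by (rule num_queries_ask)
    then show "num_queries (ask qs1 ?K) \<le> a + b" using Q1(3) by (simp add: qs1)
    fix f
    define T1 where "T1 = {x \<in> Q1. f x}"
    have T1: "Q2 (\<lambda>x. x \<in> T1) = Q2 f" by (rule Q2_cong) (simp add: T1_def)
    have "run (ask qs1 ?K) f = return_pmf (dec (\<lambda>x. x \<in> T1 \<union> {x \<in> Q2 f. f x}))"
      by (simp add: run_ask qs1 qs2 T1 flip: T1_def)
    also have "dec (\<lambda>x. x \<in> T1 \<union> {x \<in> Q2 f. f x}) = dec f"
      by (rule dec_cong [symmetric]) (auto simp: T1_def)
    finally show "run (ask qs1 ?K) f = return_pmf (dec f)" .
  qed
qed

text \<open>Each coin toss halves the index set, so \<open>N\<close> tosses pick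
  \<open>\<omega>\<close> uniformly; as tosses are not counted, the cost is that of the worst
  branch.\<close>

lemma randomized_algorithm:
  assumes "finite \<Omega>" "card \<Omega> = 2 ^ N"
    and "\<And>\<omega>. \<omega> \<in> \<Omega> \<Longrightarrow> \<exists>A. query_points A \<subseteq> D \<and> num_queries A \<le> q \<and>
      (\<forall>f. run A f = return_pmf (dec \<omega> f))"
  shows "\<exists>A. query_points A \<subseteq> D \<and> num_queries A \<le> q \<and>
    (\<forall>f. pmf (run A f) True = freq \<Omega> (\<lambda>\<omega>. dec \<omega> f))"
  using assms
proof (induction N arbitrary: \<Omega>)
  case 0
  then obtain \<omega> where \<omega>: "\<Omega> = {\<omega>}" by (auto simp: card_1_singleton_iff)
  with 0 obtain A where A: "query_points A \<subseteq> D" "num_queries A \<le> q"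
    "\<And>f. run A f = return_pmf (dec \<omega> f)" by blast
  have "pmf (run A f) True = freq \<Omega> (\<lambda>\<omega>. dec \<omega> f)" for f
  proof -
    have "{x. x = \<omega> \<and> dec x f} = (if dec \<omega> f then {\<omega>} else {})" by auto
    then show ?thesis by (simp add: A(3) \<omega> freq_def indicator_def)
  qed
  then show ?case using A by blast
next
  case (Suc N)
  obtain \<Omega>0 where \<Omega>0: "\<Omega>0 \<subseteq> \<Omega>" "card \<Omega>0 = 2 ^ N"
    by (rule obtain_subset_with_card_n [of "2 ^ N" \<Omega>]) (use Suc.prems(2) in auto)
  have fin0: "finite \<Omega>0" using \<Omega>0(1) Suc.prems(1) finite_subset by blast
  define \<Omega>1 where "\<Omega>1 = \<Omega> - \<Omega>0"
  have fin1: "finite \<Omega>1" using Suc.prems(1) by (simp add: \<Omega>1_def)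
  have \<Omega>1: "card \<Omega>1 = 2 ^ N"
    using \<Omega>0 Suc.prems(2) fin0 by (simp add: \<Omega>1_def card_Diff_subset)
  obtain A0 where A0: "query_points A0 \<subseteq> D" "num_queries A0 \<le> q"
    "\<And>f. pmf (run A0 f) True = freq \<Omega>0 (\<lambda>\<omega>. dec \<omega> f)"
    using Suc.IH [OF fin0 \<Omega>0(2)] Suc.prems(3) \<Omega>0(1) by (meson subsetD)
  obtain A1 where A1: "query_points A1 \<subseteq> D" "num_queries A1 \<le> q"
    "\<And>f. pmf (run A1 f) True = freq \<Omega>1 (\<lambda>\<omega>. dec \<omega> f)"
    using Suc.IH [OF fin1 \<Omega>1] Suc.prems(3) unfolding \<Omega>1_def by (meson DiffD1)
  let ?A = "Flip (\<lambda>b. if b then A1 else A0)"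
  have "pmf (run ?A f) True = freq \<Omega> (\<lambda>\<omega>. dec \<omega> f)" for f
  proof -
    have "card {\<omega> \<in> \<Omega>. dec \<omega> f} = card {\<omega> \<in> \<Omega>0. dec \<omega> f} + card {\<omega> \<in> \<Omega>1. dec \<omega> f}"
      using fin0 fin1 \<Omega>0(1)
      by (subst card_Un_disjoint [symmetric]) (auto simp: \<Omega>1_def intro!: arg_cong [of _ _ card])
    then have "freq \<Omega> (\<lambda>\<omega>. dec \<omega> f) = (freq \<Omega>0 (\<lambda>\<omega>. dec \<omega> f) + freq \<Omega>1 (\<lambda>\<omega>. dec \<omega> f)) / 2"
      using \<Omega>0(2) \<Omega>1 Suc.prems(2) by (simp add: freq_def field_simps)
    then show ?thesis by (simp add: pmf_bind A0(3) A1(3))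
  qed
  moreover have "query_points ?A \<subseteq> D" using A0(1) A1(1) by auto
  moreover have "num_queries ?A \<le> q" using A0(2) A1(2) by simp
  ultimately show ?case by blast
qed

section \<open>The tester\<close>

definition probes :: "nat \<Rightarrow> ((nat \<Rightarrow> bool) \<times> (nat \<Rightarrow> bool) \<times> (nat \<Rightarrow> bool) \<Rightarrow> nat \<Rightarrow> bool) set" where
  "probes n = {\<lambda>(x, y, z). x, \<lambda>(x, y, z). y, \<lambda>(x, y, z). z,
    \<lambda>(x, y, z). vadd n x (vadd n y z), \<lambda>(x, y, z). mix n z y x}"

lemma finite_probes [simp]: "finite (probes n)"
  by (simp add: probes_def)

lemma card_probes: "card (probes n) \<le> 5"
proof -
  have "card (set [a, b, c, d, e]) \<le> 5" for a b c d e :: "'a"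
    using card_length [of "[a, b, c, d, e]"] by simp
  then show ?thesis by (simp add: probes_def)
qed

lemma freq_probe: "\<psi> \<in> probes n \<Longrightarrow> freq (triples n) (\<lambda>t. P (\<psi> t)) = freq (cube n) P"
  using freq_triple1 [of n P] freq_triple2 [of n P] freq_triple3 [of n P]
    freq_triple_sum [of n P] freq_triple_mix [of n P]
  by (auto simp: probes_def case_prod_unfold)

lemma unary_test_cong:
  assumes "\<And>\<psi>. \<psi> \<in> probes n \<Longrightarrow> F (\<psi> t) = G (\<psi> t)"
  shows "unary_test n F t = unary_test n G t"
proof -
  obtain x y z where t: "t = (x, y, z)" by (cases t)
  have "F x = G x" "F y = G y" "F z = G z" "F (vadd n x (vadd n y z)) = G (vadd n x (vadd n y z))"
    "F (mix n z y x) = G (mix n z y x)"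
    using assms [of "\<lambda>(x, y, z). x"] assms [of "\<lambda>(x, y, z). y"] assms [of "\<lambda>(x, y, z). z"]
      assms [of "\<lambda>(x, y, z). vadd n x (vadd n y z)"] assms [of "\<lambda>(x, y, z). mix n z y x"]
    by (simp_all add: probes_def t)
  then show ?thesis by (simp add: t)
qed

text \<open>\<open>(1 - p) ^ S\<close> is the smallest of the S + 1 terms of a geometric sum which,
  multiplied by \<open>p\<close>, telescopes to at most 1. The bound is free of \<open>p\<close>, so
  blocks of unknown sensitivity can be treated alike.\<close>

lemma hitting_probability_le:
  fixes p :: real
  assumes "0 \<le> p" "p \<le> 1"
  shows "p * (1 - p) ^ S \<le> 1 / (real S + 1)"
proof -
  have "real (Suc S) * (1 - p) ^ S \<le> (\<Sum>i<Suc S. (1 - p) ^ i)"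
    using assms sum_bounded_below [of "{..<Suc S}" "(1 - p) ^ S" "\<lambda>i. (1 - p) ^ i"]
    by (simp add: power_decreasing)
  then have "p * (real (Suc S) * (1 - p) ^ S) \<le> p * (\<Sum>i<Suc S. (1 - p) ^ i)"
    using assms by (intro mult_left_mono)
  also have "\<dots> = 1 - (1 - p) ^ Suc S"
    using one_diff_power_eq [of "1 - p" "Suc S"] by simp
  also have "\<dots> \<le> 1" using assms by simp
  finally show ?thesis by (simp add: field_simps)
qed

text \<open>The variables are split by \<open>\<pi>\<close> into \<open>r\<close> blocks, \<open>S\<close> random pairs of points search for
  blocks on which the function depends, and \<open>m\<close> random triples serve both for testing that the
  function, restricted to a block, reads a single coordinate, and for checking
  that some list of length at most \<open>k\<close> over the block values is consistent with the function.\<close>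

locale dl_tester =
  fixes n r S m k :: nat
  assumes n_pos: "0 < n" and r_pos: "0 < r" and S_pos: "0 < S"
begin

definition partitions :: "(nat \<Rightarrow> nat) set" where
  "partitions = {..<n} \<rightarrow>\<^sub>E {..<r}"

definition searches :: "(nat \<Rightarrow> (nat \<Rightarrow> bool) \<times> (nat \<Rightarrow> bool)) set" where
  "searches = {..<S} \<rightarrow>\<^sub>E (cube n \<times> cube n)"

definition samples :: "(nat \<Rightarrow> (nat \<Rightarrow> bool) \<times> (nat \<Rightarrow> bool) \<times> (nat \<Rightarrow> bool)) set" where
  "samples = {..<m} \<rightarrow>\<^sub>E triples n"

definition differs where
  "differs f \<pi> j = (\<lambda>(w, w'). f w \<noteq> f (mix n (\<lambda>i. \<pi> i = j) w w'))"

definition found where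
  "found f \<pi> V j \<longleftrightarrow> (\<exists>s<S. differs f \<pi> j (V s))"

text \<open>An index below \<open>S\<close> is selected even for an unfound block, so that every
  block has a restriction that can be tested. The list constructed for completeness does not read
  such blocks, but soundness must allow lists that do.\<close>

definition sel where
  "sel f \<pi> V j = (SOME s. s < S \<and> (found f \<pi> V j \<longrightarrow> differs f \<pi> j (V s)))"

definition restr where
  "restr f \<pi> V j x = f (mix n (\<lambda>i. \<pi> i = j) (fst (V (sel f \<pi> V j))) x)"

text \<open>The list is quantified existentially instead of being read off from the searches: only
  queries cost anything, and soundness takes a union bound over all candidates.\<close>

fun accepts where
  "accepts f (\<pi>, V, Y) \<longleftrightarrow>
    (\<forall>j<r. \<forall>t<m. unary_test n (restr f \<pi> V j) (Y t)) \<and>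
    (\<exists>H d. length H \<le> k \<and> fst ` set H \<subseteq> {..<r} \<and>
      (\<forall>t<m. dl_default H d (\<lambda>j. restr f \<pi> V j (fst (Y t))) = f (fst (Y t))))"

declare accepts.simps [simp del]

lemma finite_spaces [simp]: "finite partitions" "finite searches" "finite samples"
  by (simp_all add: partitions_def searches_def samples_def finite_PiE)

lemma spaces_nonempty [simp]: "partitions \<noteq> {}" "searches \<noteq> {}" "samples \<noteq> {}"
  using r_pos by (auto simp: partitions_def searches_def samples_def PiE_eq_empty_iff lessThan_empty_iff)

lemma sel: "sel f \<pi> V j < S" "found f \<pi> V j \<Longrightarrow> differs f \<pi> j (V (sel f \<pi> V j))"
proof -
  have "\<exists>s. s < S \<and> (found f \<pi> V j \<longrightarrow> differs f \<pi> j (V s))"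
    using S_pos by (auto simp: found_def)
  from someI_ex [OF this] show "sel f \<pi> V j < S"
    "found f \<pi> V j \<Longrightarrow> differs f \<pi> j (V (sel f \<pi> V j))"
    unfolding sel_def by auto
qed

definition queries1 where
  "queries1 \<pi> V = (\<lambda>s. fst (V s)) ` {..<S} \<union>
    (\<lambda>(s, j). mix n (\<lambda>i. \<pi> i = j) (fst (V s)) (snd (V s))) ` ({..<S} \<times> {..<r})"

definition queries2 where
  "queries2 \<pi> V Y f = (\<lambda>t. fst (Y t)) ` {..<m} \<union>
    (\<lambda>(t, j, \<psi>). mix n (\<lambda>i. \<pi> i = j) (fst (V (sel f \<pi> V j))) (\<psi> (Y t))) `
      ({..<m} \<times> {..<r} \<times> probes n)"

lemma sel_cong:
  assumes "\<And>x. x \<in> queries1 \<pi> V \<Longrightarrow> f x = g x" "j < r"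
  shows "found f \<pi> V j = found g \<pi> V j" "sel f \<pi> V j = sel g \<pi> V j"
proof -
  have d: "differs f \<pi> j (V s) = differs g \<pi> j (V s)" if "s < S" for s
    using assms that by (force simp: queries1_def differs_def case_prod_unfold)
  then show f: "found f \<pi> V j = found g \<pi> V j" by (auto simp: found_def)
  show "sel f \<pi> V j = sel g \<pi> V j"
    unfolding sel_def f using d by (intro arg_cong [of _ _ Eps]) auto
qed

lemma accepts_cong:
  assumes "\<And>x. x \<in> queries1 \<pi> V \<union> queries2 \<pi> V Y f \<Longrightarrow> f x = g x"
  shows "accepts f (\<pi>, V, Y) = accepts g (\<pi>, V, Y)"
proof -
  have s: "sel f \<pi> V j = sel g \<pi> V j" if "j < r" for j
    using sel_cong(2) [of \<pi> V f g j] assms that by auto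
  have restr: "restr f \<pi> V j (\<psi> (Y t)) = restr g \<pi> V j (\<psi> (Y t))"
    if "j < r" "t < m" "\<psi> \<in> probes n" for j t \<psi>
  proof -
    have "mix n (\<lambda>i. \<pi> i = j) (fst (V (sel f \<pi> V j))) (\<psi> (Y t)) \<in> queries2 \<pi> V Y f"
      using that by (force simp: queries2_def)
    then show ?thesis using assms s [OF that(1)] by (simp add: restr_def)
  qed
  have "(\<lambda>(x, y, z). x) \<in> probes n" by (simp add: probes_def)
  from restr [OF _ _ this] have restr1: "restr f \<pi> V j (fst (Y t)) = restr g \<pi> V j (fst (Y t))"
    if "j < r" "t < m" for j t
    using that by (simp add: case_prod_unfold)
  have "unary_test n (restr f \<pi> V j) (Y t) = unary_test n (restr g \<pi> V j) (Y t)"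
    if "j < r" "t < m" for j t
    using restr that by (intro unary_test_cong) auto
  moreover have "dl_default H d (\<lambda>j. restr f \<pi> V j (fst (Y t))) = dl_default H d (\<lambda>j. restr g \<pi> V j (fst (Y t)))"
    if "fst ` set H \<subseteq> {..<r}" "t < m" for H d t
    using that restr1 by (intro dl_default_cong) blast
  moreover have "f (fst (Y t)) = g (fst (Y t))" if "t < m" for t
    using assms that by (auto simp: queries2_def)
  ultimately show ?thesis
    by (simp add: accepts.simps cong: conj_cong)
qed

lemma card_queries1: "card (queries1 \<pi> V) \<le> S + S * r"
  unfolding queries1_def
  by (intro order_trans [OF card_Un_le] add_mono order_trans [OF card_image_le])
    (simp_all add: card_cartesian_product)

lemma card_queries2: "card (queries2 \<pi> V Y f) \<le> m + m * r * 5"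
proof -
  have "card ({..<m} \<times> {..<r} \<times> probes n) \<le> m * r * 5"
    using card_probes [of n] by (simp add: card_cartesian_product)
  then show ?thesis
    unfolding queries2_def
    by (intro order_trans [OF card_Un_le] add_mono order_trans [OF card_image_le]) simp_all
qed

lemma decision_algorithm:
  assumes "V \<in> searches" "Y \<in> samples"
  shows "\<exists>A. query_points A \<subseteq> cube n \<and> num_queries A \<le> (S + S * r) + (m + m * r * 5) \<and>
    (\<forall>f. run A f = return_pmf (accepts f (\<pi>, V, Y)))"
proof -
  have V: "fst (V s) \<in> cube n" if "s < S" for s
    using assms(1) that by (auto simp: searches_def PiE_iff mem_Times_iff)
  have Y: "fst (Y t) \<in> cube n" if "t < m" for t
    using assms(2) that by (auto simp: samples_def PiE_iff mem_Times_iff)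
  obtain A where "query_points A \<subseteq> cube n" "num_queries A \<le> (S + S * r) + (m + m * r * 5)"
    "\<And>f. run A f = return_pmf (accepts f (\<pi>, V, Y))"
  proof (rule two_round_algorithm)
    show "finite (queries1 \<pi> V)" by (simp add: queries1_def)
    show "queries1 \<pi> V \<subseteq> cube n" using V by (auto simp: queries1_def)
    show "card (queries1 \<pi> V) \<le> S + S * r" by (rule card_queries1)
    show "finite (queries2 \<pi> V Y f)" for f by (simp add: queries2_def)
    show "queries2 \<pi> V Y f \<subseteq> cube n" for f using Y by (auto simp: queries2_def)
    show "card (queries2 \<pi> V Y f) \<le> m + m * r * 5" for f by (rule card_queries2)
    show "queries2 \<pi> V Y f = queries2 \<pi> V Y g" if "\<And>x. x \<in> queries1 \<pi> V \<Longrightarrow> f x = g x" for f g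
      using sel_cong(2) [OF that]
      by (auto simp: queries2_def intro!: image_cong arg_cong2 [of _ _ _ _ "(\<union>)"])
    show "accepts f (\<pi>, V, Y) = accepts g (\<pi>, V, Y)"
      if "\<And>x. x \<in> queries1 \<pi> V \<union> queries2 \<pi> V Y f \<Longrightarrow> f x = g x" for f g
      using that by (rule accepts_cong)
  qed (rule that)
  then show ?thesis by blast
qed

subsection \<open>Soundness\<close>

text \<open>Replacing the \<open>r\<close> block functions by their unary approximants changes the
  list on a fraction of at most 2 \<eta> r \<le> \<epsilon> / 2, and the result is a decision list,
  at distance at least \<epsilon> from \<open>f\<close>.\<close>

lemma consistency_bound:
  assumes far: "\<And>g. g \<in> Decision_List n \<Longrightarrow> \<epsilon> \<le> freq (cube n) (\<lambda>x. f x \<noteq> g x)"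
    and close: "\<And>j. j < r \<Longrightarrow> \<iota> j < n"
      "\<And>j. j < r \<Longrightarrow> freq (cube n) (\<lambda>x. F j x \<noteq> \<phi> j (x (\<iota> j))) \<le> 2 * \<eta>"
    and \<eta>: "4 * \<eta> * real r \<le> \<epsilon>" and H: "fst ` set H \<subseteq> {..<r}"
  shows "freq (cube n) (\<lambda>x. dl_default H d (\<lambda>j. F j x) = f x) \<le> 1 - \<epsilon> / 2"
proof -
  let ?h = "\<lambda>x. dl_default H d (\<lambda>j. F j x)"
  obtain L where L: "fst ` set L \<subseteq> {..<n}"
    "\<And>x. dl_default L d x = dl_default H d (\<lambda>j. \<phi> j (x (\<iota> j)))"
    using dl_default_subst_unary [where H = H and r = r and \<iota> = \<iota> and n = n and d = d and \<phi> = \<phi>]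
      H close(1) by blast
  have "\<epsilon> \<le> freq (cube n) (\<lambda>x. f x \<noteq> dl_default L d x)"
    by (rule far [OF dl_default_in_Decision_List [OF n_pos L(1)]])
  also have "\<dots> \<le> freq (cube n) (\<lambda>x. \<not> ?h x = f x \<or> (\<exists>j\<in>{..<r}. F j x \<noteq> \<phi> j (x (\<iota> j))))"
  proof (rule freq_mono)
    fix x assume neq: "f x \<noteq> dl_default L d x"
    have "?h x = dl_default L d x" if "\<And>j. j \<in> {..<r} \<Longrightarrow> F j x = \<phi> j (x (\<iota> j))"
      unfolding L(2) using that H by (intro dl_default_cong) blast
    then show "\<not> ?h x = f x \<or> (\<exists>j\<in>{..<r}. F j x \<noteq> \<phi> j (x (\<iota> j)))" using neq by auto
  qed simp
  also have "\<dots> \<le> freq (cube n) (\<lambda>x. \<not> ?h x = f x)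
      + freq (cube n) (\<lambda>x. \<exists>j\<in>{..<r}. F j x \<noteq> \<phi> j (x (\<iota> j)))"
    by (rule freq_disj_le) simp
  also have "freq (cube n) (\<lambda>x. \<not> ?h x = f x) = 1 - freq (cube n) (\<lambda>x. ?h x = f x)"
    by (rule freq_not) simp_all
  also have "freq (cube n) (\<lambda>x. \<exists>j\<in>{..<r}. F j x \<noteq> \<phi> j (x (\<iota> j))) \<le> real (card {..<r}) * (2 * \<eta>)"
    by (rule freq_Bex_le_card) (use close(2) in auto)
  finally show ?thesis using \<eta> by (simp add: algebra_simps)
qed

text \<open>For fixed \<open>\<pi>\<close> and \<open>V\<close> the block functions are fixed and
  the samples independent of them. Either a single test rejects some block function with probability
  above \<eta>, or all are nearly unary and the union bound over lists applies.\<close>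

lemma accepts_far_le:
  assumes far: "\<And>g. g \<in> Decision_List n \<Longrightarrow> \<epsilon> \<le> freq (cube n) (\<lambda>x. f x \<noteq> g x)"
    and \<eta>: "0 \<le> \<eta>" "\<eta> \<le> 1 / 200" "4 * \<eta> * real r \<le> \<epsilon>" and \<epsilon>: "\<epsilon> \<le> 1"
    and b: "(1 - \<eta>) ^ m \<le> b" "2 * (4 * real r + 1) ^ k * (1 - \<epsilon> / 2) ^ m \<le> b"
  shows "freq (partitions \<times> searches \<times> samples) (accepts f) \<le> b"
proof -
  have b0: "0 \<le> b" using order_trans [OF zero_le_power b(1)] \<eta>(2) by simp
  have e0: "0 \<le> \<epsilon>" using \<eta>(1,3) by (meson mult_nonneg_nonneg of_nat_0_le_iff order_trans zero_le_numeral)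
  have "freq samples (\<lambda>Y. accepts f (\<pi>, V, Y)) \<le> b" for \<pi> V
  proof (cases "\<exists>j<r. freq (triples n) (\<lambda>t. \<not> unary_test n (restr f \<pi> V j) t) > \<eta>")
    case True
    then obtain j where j: "j < r" "freq (triples n) (\<lambda>t. \<not> unary_test n (restr f \<pi> V j) t) > \<eta>"
      by blast
    have "freq samples (\<lambda>Y. accepts f (\<pi>, V, Y))
        \<le> freq samples (\<lambda>Y. \<forall>t\<in>{..<m}. unary_test n (restr f \<pi> V j) (Y t))"
      using j by (intro freq_mono) (auto simp: accepts.simps)
    also have "\<dots> = freq (triples n) (unary_test n (restr f \<pi> V j)) ^ m"
      unfolding samples_def by (simp add: freq_PiE [where P = "\<lambda>_. unary_test n (restr f \<pi> V j)"])
    also have "\<dots> \<le> (1 - \<eta>) ^ m"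
      using j(2) by (intro power_mono) (simp_all add: freq_not freq_nonneg)
    finally show ?thesis using b(1) by linarith
  next
    case False
    have "\<forall>j. \<exists>i \<phi>. j < r \<longrightarrow> i < n \<and> freq (cube n) (\<lambda>x. restr f \<pi> V j x \<noteq> \<phi> (x i)) \<le> 2 * \<eta>"
    proof (intro allI)
      fix j
      show "\<exists>i \<phi>. j < r \<longrightarrow> i < n \<and> freq (cube n) (\<lambda>x. restr f \<pi> V j x \<noteq> \<phi> (x i)) \<le> 2 * \<eta>"
      proof (cases "j < r")
        case True
      have "freq (triples n) (\<lambda>t. \<not> unary_test n (restr f \<pi> V j) t) \<le> \<eta>"
        using False True by (meson not_less)
        then obtain i \<phi> where "i < n" "freq (cube n) (\<lambda>x. restr f \<pi> V j x \<noteq> \<phi> (x i)) \<le> 2 * \<eta>"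
          by (rule unary_test_sound [OF _ \<eta>(2) n_pos])
        then show ?thesis by blast
      qed simp
    qed
    from choice [OF this] obtain \<iota> where
      "\<forall>j. \<exists>\<phi>. j < r \<longrightarrow> \<iota> j < n \<and> freq (cube n) (\<lambda>x. restr f \<pi> V j x \<noteq> \<phi> (x (\<iota> j))) \<le> 2 * \<eta>" ..
    from choice [OF this] obtain \<phi> where close: "\<And>j. j < r \<Longrightarrow> \<iota> j < n"
      "\<And>j. j < r \<Longrightarrow> freq (cube n) (\<lambda>x. restr f \<pi> V j x \<noteq> \<phi> j (x (\<iota> j))) \<le> 2 * \<eta>"
      by blast
    define \<H> where "\<H> = {H :: decision_list. length H \<le> k \<and> fst ` set H \<subseteq> {..<r}}"
    let ?I = "\<H> \<times> (UNIV :: bool set)"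
    let ?P = "\<lambda>H d x. dl_default H d (\<lambda>j. restr f \<pi> V j x) = f x"
    have fin: "finite \<H>" unfolding \<H>_def by (rule card_decision_lists)
    have "card ?I \<le> 2 * (4 * r + 1) ^ k"
      unfolding card_cartesian_product
      using mult_le_mono1 [OF card_decision_lists(2) [of k r, folded \<H>_def], of 2]
      by (simp only: card_UNIV_bool mult.commute)
    then have "real (card ?I) \<le> real (2 * (4 * r + 1) ^ k)"
      by (rule of_nat_mono)
    then have cardI: "real (card ?I) \<le> 2 * (4 * real r + 1) ^ k"
      by (simp only: of_nat_mult of_nat_power of_nat_add of_nat_numeral of_nat_1)
    have "freq samples (\<lambda>Y. accepts f (\<pi>, V, Y))
        \<le> freq samples (\<lambda>Y. \<exists>i\<in>?I. \<forall>t\<in>{..<m}. ?P (fst i) (snd i) (fst (Y t)))"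
    proof (rule freq_mono)
      fix Y assume "accepts f (\<pi>, V, Y)"
      then have "\<exists>H d. length H \<le> k \<and> fst ` set H \<subseteq> {..<r} \<and> (\<forall>t<m. ?P H d (fst (Y t)))"
        by (simp add: accepts.simps)
      then obtain H d where "length H \<le> k" "fst ` set H \<subseteq> {..<r}" "\<forall>t<m. ?P H d (fst (Y t))"
        by (elim exE conjE)
      then have "(H, d) \<in> ?I" "\<forall>t\<in>{..<m}. ?P H d (fst (Y t))"
        unfolding \<H>_def by blast+
      then show "\<exists>i\<in>?I. \<forall>t\<in>{..<m}. ?P (fst i) (snd i) (fst (Y t))"
        by (intro bexI [of _ "(H, d)"]) simp_all
    qed simp
    also have "\<dots> \<le> real (card ?I) * (1 - \<epsilon> / 2) ^ m"
    proof (rule freq_Bex_le_card)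
      fix i assume i: "i \<in> ?I"
      have "freq samples (\<lambda>Y. \<forall>t\<in>{..<m}. ?P (fst i) (snd i) (fst (Y t)))
          = freq (triples n) (\<lambda>t. ?P (fst i) (snd i) (fst t)) ^ m"
        unfolding samples_def by (simp add: freq_PiE [where P = "\<lambda>_ t. ?P (fst i) (snd i) (fst t)"])
      also have "freq (triples n) (\<lambda>t. ?P (fst i) (snd i) (fst t)) = freq (cube n) (?P (fst i) (snd i))"
        using freq_triple1 [of n "?P (fst i) (snd i)"] by (simp add: case_prod_unfold)
      also have "\<dots> ^ m \<le> (1 - \<epsilon> / 2) ^ m"
      proof (rule power_mono [OF _ freq_nonneg])
        have "fst ` set (fst i) \<subseteq> {..<r}" using i unfolding \<H>_def mem_Times_iff mem_Collect_eq by (elim conjE)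
        then show "freq (cube n) (?P (fst i) (snd i)) \<le> 1 - \<epsilon> / 2"
          by (intro consistency_bound [OF far close \<eta>(3)])
      qed
      finally show "freq samples (\<lambda>Y. \<forall>t\<in>{..<m}. ?P (fst i) (snd i) (fst (Y t))) \<le> (1 - \<epsilon> / 2) ^ m" .
    qed (use fin in auto)
    also have "\<dots> \<le> 2 * (4 * real r + 1) ^ k * (1 - \<epsilon> / 2) ^ m"
      using cardI \<epsilon> by (intro mult_right_mono) auto
    finally show ?thesis using b(2) by linarith
  qed
  then show ?thesis using b0 by (intro freq_Times_le) auto
qed

subsection \<open>Completeness\<close>

context
  fixes M :: decision_list and d :: bool and \<pi> :: "nat \<Rightarrow> nat" and g :: "(nat \<Rightarrow> bool) \<Rightarrow> bool"
  defines "g \<equiv> dl_default M d"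
  assumes len: "length M \<le> k" and vars: "fst ` set M \<subseteq> {..<n}"
    and inj: "inj_on \<pi> (fst ` set M)" and \<pi>: "\<And>i. i < n \<Longrightarrow> \<pi> i < r"
begin

text \<open>By injectivity \<open>i\<close> is the only variable of \<open>M\<close> in its block,
  so among the exchanged coordinates only \<open>i\<close> matters.\<close>

lemma mix_block:
  assumes "i \<in> fst ` set M"
  shows "g (mix n (\<lambda>i'. \<pi> i' = \<pi> i) w x) = g (w(i := x i))"
  unfolding g_def
proof (rule dl_default_cong)
  fix i' assume "i' \<in> fst ` set M"
  then show "mix n (\<lambda>i'. \<pi> i' = \<pi> i) w x i' = (w(i := x i)) i'"
    using vars assms inj_on_eq_iff [OF inj, of i' i] by (subst mix_apply) auto
qed

lemma mix_irrelevant_block: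
  assumes "j \<notin> \<pi> ` fst ` set M"
  shows "g (mix n (\<lambda>i. \<pi> i = j) w x) = g w"
  unfolding g_def
proof (rule dl_default_cong)
  fix i assume "i \<in> fst ` set M"
  then show "mix n (\<lambda>i. \<pi> i = j) w x i = w i"
    using vars assms by (subst mix_apply) auto
qed

lemma restr_unary:
  obtains i \<phi> where "i < n" "\<And>x. restr g \<pi> V j x = \<phi> (x i)"
proof (cases "j \<in> \<pi> ` fst ` set M")
  case True
  then obtain i where i: "i \<in> fst ` set M" "j = \<pi> i" by blast
  show thesis
  proof (rule that)
    show "i < n" using i(1) vars by auto
    show "restr g \<pi> V j x = (\<lambda>b. g ((fst (V (sel g \<pi> V j)))(i := b))) (x i)" for x
      by (simp add: restr_def i(2) mix_block [OF i(1)])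
  qed
next
  case False
  show thesis
    by (rule that [OF n_pos, of "\<lambda>b. g (fst (V (sel g \<pi> V j)))"])
      (simp add: restr_def mix_irrelevant_block [OF False])
qed

text \<open>The selected pair shows that the restriction is not constant; as a function of the
  single bit \<open>x i\<close> it is then a literal.\<close>

lemma restr_literal:
  assumes "i \<in> fst ` set M" "found g \<pi> V (\<pi> i)"
  shows "\<exists>c. \<forall>x. restr g \<pi> V (\<pi> i) x = (x i \<noteq> c)"
proof -
  define w where "w = fst (V (sel g \<pi> V (\<pi> i)))"
  define w' where "w' = snd (V (sel g \<pi> V (\<pi> i)))"
  have r: "restr g \<pi> V (\<pi> i) x = g (w(i := x i))" for x
    by (simp add: restr_def mix_block [OF assms(1)] w_def)
  have "g w \<noteq> g (w(i := w' i))"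
    using sel(2) [OF assms(2)]
    by (simp add: differs_def case_prod_unfold mix_block [OF assms(1)] w_def w'_def)
  then have "g (w(i := w i)) \<noteq> g (w(i := w' i))" by simp
  then have "g (w(i := True)) \<noteq> g (w(i := False))"
    by (cases "w i"; cases "w' i") auto
  then have lit: "g (w(i := b)) = (b \<noteq> (\<not> g (w(i := True))))" for b by (cases b) auto
  have "\<forall>x. restr g \<pi> V (\<pi> i) x = (x i \<noteq> (\<not> g (w(i := True))))"
    unfolding r by (intro allI lit)
  then show ?thesis by (rule exI)
qed

text \<open>The same \<open>z\<close> fixes the unfound variables for all samples, so one list
  \<open>H\<close> serves them all. The unary tests pass with certainty, since each block holds at
  most one variable of \<open>M\<close>.\<close>

lemma accepts_if_unfound_negligible:
  assumes Y: "Y \<in> samples"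
    and neg: "\<And>t. t < m \<Longrightarrow> g (fst (Y t)) = g (mix n (\<lambda>i. \<not> found g \<pi> V (\<pi> i)) (fst (Y t)) z)"
  shows "accepts g (\<pi>, V, Y)"
proof -
  have Yt: "Y t \<in> triples n" if "t < m" for t
    using Y that by (auto simp: samples_def PiE_iff)
  have "unary_test n (restr g \<pi> V j) (Y t)" if "t < m" for j t
  proof (rule restr_unary [of V j])
    fix i \<phi> assume "i < n" "\<And>x. restr g \<pi> V j x = \<phi> (x i)"
    then show ?thesis by (rule unary_test_complete [OF _ _ Yt [OF that]])
  qed
  moreover have "\<exists>H d'. length H \<le> length M \<and> fst ` set H \<subseteq> {..<r} \<and>
    (\<forall>x\<in>UNIV. dl_default H d' (\<lambda>j. restr g \<pi> V j x)
      = dl_default M d (\<lambda>i. if found g \<pi> V (\<pi> i) then x i else z i))"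
  proof (rule dl_default_read_off)
    fix i assume i: "i \<in> fst ` set M"
    then show "\<pi> i < r" using vars \<pi> by blast
    assume "found g \<pi> V (\<pi> i)"
    with restr_literal [OF i] show "\<exists>c. \<forall>x\<in>UNIV. restr g \<pi> V (\<pi> i) x = (x i \<noteq> c)"
      by simp
  qed
  then obtain H d' where H: "length H \<le> length M" "fst ` set H \<subseteq> {..<r}"
    "\<forall>x\<in>UNIV. dl_default H d' (\<lambda>j. restr g \<pi> V j x)
      = dl_default M d (\<lambda>i. if found g \<pi> V (\<pi> i) then x i else z i)"
    by (elim exE conjE)
  have H_eq: "dl_default H d' (\<lambda>j. restr g \<pi> V j x)
      = dl_default M d (\<lambda>i. if found g \<pi> V (\<pi> i) then x i else z i)" for x
    using H(3) by simp
  have "dl_default H d' (\<lambda>j. restr g \<pi> V j (fst (Y t))) = g (fst (Y t))" if "t < m" for t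
    unfolding H_eq neg [OF that] unfolding g_def
    by (rule dl_default_cong) (use vars in \<open>auto simp: mix_apply\<close>)
  moreover have "length H \<le> k" using H(1) len by simp
  ultimately show ?thesis unfolding accepts.simps using H(2) by blast
qed

text \<open>Replace the coordinates of \<open>x\<close> in unfound blocks by those of \<open>z\<close>, one block after the
  other. If this changes the value of \<open>g\<close>, some step does; up to swapping the coordinates already
  replaced, that step is a fresh random pair for its block, and a block which is sensitive with
  probability \<open>p\<close> remains unfound with probability \<open>(1 - p) ^ S\<close>.\<close>

lemma freq_unfound_relevant:
  "freq (searches \<times> (cube n \<times> cube n))
      (\<lambda>(V, x, z). g x \<noteq> g (mix n (\<lambda>i. \<not> found g \<pi> V (\<pi> i)) x z))
    \<le> real r / (real S + 1)"
proof -
  let ?CC = "cube n \<times> cube n"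
  define U where "U V j i \<longleftrightarrow> \<not> found g \<pi> V (\<pi> i) \<and> \<pi> i < j" for V j i
  let ?step = "\<lambda>j (V, x, z). \<not> found g \<pi> V j \<and> g (mix n (U V j) x z) \<noteq> g (mix n (U V (Suc j)) x z)"
  have "freq (searches \<times> ?CC) (\<lambda>(V, x, z). g x \<noteq> g (mix n (\<lambda>i. \<not> found g \<pi> V (\<pi> i)) x z))
      \<le> freq (searches \<times> ?CC) (\<lambda>\<omega>. \<exists>j\<in>{..<r}. ?step j \<omega>)"
  proof (rule freq_mono)
    fix \<omega> assume \<omega>: "\<omega> \<in> searches \<times> ?CC"
      and neq: "case \<omega> of (V, x, z) \<Rightarrow> g x \<noteq> g (mix n (\<lambda>i. \<not> found g \<pi> V (\<pi> i)) x z)"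
    obtain V x z where Vxz: "\<omega> = (V, x, z)" by (cases \<omega>)
    have x: "mix n (U V 0) x z = x"
      using \<omega> by (intro cube_eqI [of _ n]) (auto simp: Vxz U_def mix_apply)
    have "mix n (U V r) x z = mix n (\<lambda>i. \<not> found g \<pi> V (\<pi> i)) x z"
      by (intro cube_eqI [of _ n]) (auto simp: U_def mix_apply \<pi>)
    then have ne: "g (mix n (U V 0) x z) \<noteq> g (mix n (U V r) x z)"
      using neq by (simp add: Vxz x)
    have "\<exists>j<r. g (mix n (U V j) x z) \<noteq> g (mix n (U V (Suc j)) x z)"
    proof (rule ccontr)
      assume *: "\<not> ?thesis"
      have "j \<le> r \<Longrightarrow> g (mix n (U V j) x z) = g (mix n (U V 0) x z)" for j
        by (induction j) (use * in auto)
      then show False using ne by blast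
    qed
    then obtain j where j: "j < r" "g (mix n (U V j) x z) \<noteq> g (mix n (U V (Suc j)) x z)" by blast
    have "\<not> found g \<pi> V j"
    proof
      assume "found g \<pi> V j"
      then have "U V (Suc j) = U V j" by (auto simp: U_def less_Suc_eq fun_eq_iff)
      then show False using j(2) by simp
    qed
    then show "\<exists>j\<in>{..<r}. ?step j \<omega>" using j by (auto simp: Vxz)
  qed simp
  also have "\<dots> \<le> real (card {..<r}) * (1 / (real S + 1))"
  proof (rule freq_Bex_le_card)
    fix j assume "j \<in> {..<r}"
    define p where "p = freq ?CC (differs g \<pi> j)"
    have p: "0 \<le> p" "p \<le> 1" by (simp_all add: p_def freq_nonneg freq_le_1)
    have "freq (searches \<times> ?CC) (?step j)
        = freq (searches \<times> ?CC) (\<lambda>(V, xz). \<not> found g \<pi> V j \<and> differs g \<pi> j xz)"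
    proof (rule freq_Times_cong_snd)
      fix V
      show "freq ?CC (\<lambda>xz. ?step j (V, xz))
          = freq ?CC (\<lambda>xz. case (V, xz) of (V, xz) \<Rightarrow> \<not> found g \<pi> V j \<and> differs g \<pi> j xz)"
      proof (cases "found g \<pi> V j")
        case False
        \<comment> \<open>Exchanging the coordinates in \<open>U V j\<close> leaves block
          \<open>j\<close> of both points untouched, so step \<open>j\<close> is the event
          \<open>differs\<close> for the exchanged pair, which for fixed \<open>V\<close> is again
          uniform.\<close>
        have "mix n (U V (Suc j)) x z
            = mix n (\<lambda>i. \<pi> i = j) (mix n (U V j) x z) (mix n (U V j) z x)" for x z
          using False
          by (intro cube_eqI [of _ n]) (auto simp: U_def mix_apply less_Suc_eq)
        then have "freq ?CC (\<lambda>xz. ?step j (V, xz))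
            = freq ?CC (\<lambda>(x, z). differs g \<pi> j (mix n (U V j) x z, mix n (U V j) z x))"
          using False by (simp add: differs_def case_prod_unfold)
        also have "\<dots> = freq ?CC (\<lambda>(x, z). differs g \<pi> j (x, z))"
          by (rule freq_mix_pair)
        finally show ?thesis using False by simp
      qed (simp add: freq_False case_prod_unfold)
    qed simp_all
    also have "\<dots> = freq searches (\<lambda>V. \<not> found g \<pi> V j) * p"
      unfolding p_def by (rule freq_conj_Times) simp_all
    also have "freq searches (\<lambda>V. \<not> found g \<pi> V j)
        = freq searches (\<lambda>V. \<forall>s\<in>{..<S}. \<not> differs g \<pi> j (V s))"
      by (simp add: found_def Ball_def)
    also have "\<dots> = (1 - p) ^ S"
      unfolding searches_def p_def
      by (simp add: freq_PiE [where P = "\<lambda>_ v. \<not> differs g \<pi> j v"] freq_not)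
    also have "(1 - p) ^ S * p \<le> 1 / (real S + 1)"
      using hitting_probability_le [OF p] by (simp add: mult.commute)
    finally show "freq (searches \<times> ?CC) (?step j) \<le> 1 / (real S + 1)" .
  qed simp_all
  finally show ?thesis by simp
qed

text \<open>\<open>z\<close> is an auxiliary uniform point that the tester never draws. Acceptance
  does not depend on it, so it can be added to the probability space, where each sample point forms
  a uniform pair with it.\<close>

lemma freq_rejects_short_list:
  "freq (searches \<times> samples) (\<lambda>(V, Y). \<not> accepts g (\<pi>, V, Y)) \<le> real m * real r / (real S + 1)"
proof -
  let ?bad = "\<lambda>V x z. g x \<noteq> g (mix n (\<lambda>i. \<not> found g \<pi> V (\<pi> i)) x z)"
  let ?\<Omega> = "searches \<times> (samples \<times> cube n)"
  have "freq (searches \<times> samples) (\<lambda>(V, Y). \<not> accepts g (\<pi>, V, Y))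
      = freq ?\<Omega> (\<lambda>(V, Y, z). \<not> accepts g (\<pi>, V, Y))"
    by (rule freq_Times_cong_snd) (simp_all add: freq_fst)
  also have "\<dots> \<le> freq ?\<Omega> (\<lambda>\<omega>. \<exists>t\<in>{..<m}. case \<omega> of (V, Y, z) \<Rightarrow> ?bad V (fst (Y t)) z)"
  proof (rule freq_mono)
    fix \<omega> assume \<omega>: "\<omega> \<in> ?\<Omega>" and rej: "case \<omega> of (V, Y, z) \<Rightarrow> \<not> accepts g (\<pi>, V, Y)"
    obtain V Y z where VYz: "\<omega> = (V, Y, z)" by (cases \<omega>)
    show "\<exists>t\<in>{..<m}. case \<omega> of (V, Y, z) \<Rightarrow> ?bad V (fst (Y t)) z"
    proof (rule ccontr)
      assume "\<not> ?thesis"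
      then have "accepts g (\<pi>, V, Y)"
        using \<omega> by (intro accepts_if_unfound_negligible [of Y V z]) (auto simp: VYz)
      then show False using rej by (simp add: VYz)
    qed
  qed simp
  also have "\<dots> \<le> real (card {..<m}) * (real r / (real S + 1))"
  proof (rule freq_Bex_le_card)
    fix t assume t: "t \<in> {..<m}"
    have "freq ?\<Omega> (\<lambda>\<omega>. case \<omega> of (V, Y, z) \<Rightarrow> ?bad V (fst (Y t)) z)
        = freq (searches \<times> (cube n \<times> cube n)) (\<lambda>(V, x, z). ?bad V x z)"
    proof (rule freq_Times_cong_snd)
      fix V
      have "freq (samples \<times> cube n) (\<lambda>(Y, z). ?bad V (fst (Y t)) z)
          = freq (cube n \<times> cube n) (\<lambda>(x, z). ?bad V x z)"
      proof (rule freq_Times_cong_fst)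
        fix z
        have "freq samples (\<lambda>Y. ?bad V (fst (Y t)) z) = freq (triples n) (\<lambda>y. ?bad V (fst y) z)"
          unfolding samples_def by (rule freq_PiE_at) (use t in simp_all)
        also have "\<dots> = freq (cube n) (\<lambda>x. ?bad V x z)"
          using freq_triple1 [of n "\<lambda>x. ?bad V x z"] by (simp add: case_prod_unfold)
        finally show "freq samples (\<lambda>Y. case (Y, z) of (Y, z) \<Rightarrow> ?bad V (fst (Y t)) z)
            = freq (cube n) (\<lambda>x. case (x, z) of (x, z) \<Rightarrow> ?bad V x z)"
          by simp
      qed simp_all
      then show "freq (samples \<times> cube n) (\<lambda>b. case (V, b) of (V, Y, z) \<Rightarrow> ?bad V (fst (Y t)) z)
          = freq (cube n \<times> cube n) (\<lambda>b. case (V, b) of (V, x, z) \<Rightarrow> ?bad V x z)"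
        by simp
    qed simp_all
    then show "freq ?\<Omega> (\<lambda>\<omega>. case \<omega> of (V, Y, z) \<Rightarrow> ?bad V (fst (Y t)) z) \<le> real r / (real S + 1)"
      using freq_unfound_relevant by simp
  qed simp_all
  finally show ?thesis by simp
qed

end

section \<open>Stability of the verdict under rare changes of the function\<close>

lemma freq_search_sample:
  assumes "s < S" "t < m"
  shows "freq (searches \<times> samples) (\<lambda>(V, Y). P (V s) (Y t))
    = freq ((cube n \<times> cube n) \<times> triples n) (\<lambda>(v, y). P v y)"
proof -
  have "freq (searches \<times> samples) (\<lambda>(V, Y). P (V s) (Y t))
      = freq (searches \<times> triples n) (\<lambda>(V, y). P (V s) y)"
    unfolding samples_def
    by (rule freq_Times_cong_snd)
      (use assms in \<open>simp_all add: freq_PiE_at finite_PiE\<close>)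
  also have "\<dots> = freq ((cube n \<times> cube n) \<times> triples n) (\<lambda>(v, y). P v y)"
    unfolding searches_def
    by (rule freq_Times_cong_fst)
      (use assms in \<open>simp_all add: finite_PiE freq_PiE_at [where P = "\<lambda>v. P v y" for y]\<close>)
  finally show ?thesis .
qed

text \<open>Every point that might be queried is uniformly distributed, whichever search pair is selected
  for a block, so functions that differ rarely are treated alike.\<close>

lemma freq_accepts_differently:
  fixes f g \<pi>
  defines "e \<equiv> freq (cube n) (\<lambda>x. f x \<noteq> g x)"
  shows "freq (searches \<times> samples) (\<lambda>(V, Y). accepts f (\<pi>, V, Y) \<noteq> accepts g (\<pi>, V, Y))
    \<le> (real S + real S * real r + real m + 5 * real S * real r * real m) * e"
proof -
  let ?E = "\<lambda>x. f x \<noteq> g x"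
  let ?\<Omega> = "searches \<times> samples"
  let ?mix = "\<lambda>j. mix n (\<lambda>i. \<pi> i = j)"
  let ?A = "\<lambda>\<omega>. \<exists>s\<in>{..<S}. ?E (fst (fst \<omega> s))"
  let ?B = "\<lambda>\<omega>. \<exists>p\<in>{..<S} \<times> {..<r}. ?E (?mix (snd p) (fst (fst \<omega> (fst p))) (snd (fst \<omega> (fst p))))"
  let ?C = "\<lambda>\<omega>. \<exists>t\<in>{..<m}. ?E (fst (snd \<omega> t))"
  \<comment> \<open>All \<open>s\<close> are covered, not just the selected one, since the pair at a
    fixed index is uniform. This costs the factor \<open>S\<close> in the last term.\<close>
  let ?D = "\<lambda>\<omega>. \<exists>p\<in>{..<S} \<times> {..<r} \<times> {..<m} \<times> probes n.
    ?E (?mix (fst (snd p)) (fst (fst \<omega> (fst p))) (snd (snd (snd p)) (snd \<omega> (fst (snd (snd p))))))"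
  have e0: "0 \<le> e" by (simp add: e_def freq_nonneg)
  have "freq ?\<Omega> (\<lambda>(V, Y). accepts f (\<pi>, V, Y) \<noteq> accepts g (\<pi>, V, Y))
      \<le> freq ?\<Omega> (\<lambda>\<omega>. ?A \<omega> \<or> ?B \<omega> \<or> ?C \<omega> \<or> ?D \<omega>)"
  proof (rule freq_mono)
    fix \<omega> assume neq: "case \<omega> of (V, Y) \<Rightarrow> accepts f (\<pi>, V, Y) \<noteq> accepts g (\<pi>, V, Y)"
    obtain V Y where VY: "\<omega> = (V, Y)" by (cases \<omega>)
    have "accepts f (\<pi>, V, Y) \<noteq> accepts g (\<pi>, V, Y)" using neq by (simp add: VY)
    then have "\<not> (\<forall>x \<in> queries1 \<pi> V \<union> queries2 \<pi> V Y f. f x = g x)"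
      using accepts_cong [of \<pi> V Y f g] by blast
    then obtain x where x: "x \<in> queries1 \<pi> V \<union> queries2 \<pi> V Y f" "f x \<noteq> g x" by blast
    from x(1) show "?A \<omega> \<or> ?B \<omega> \<or> ?C \<omega> \<or> ?D \<omega>"
      unfolding queries1_def queries2_def
    proof (elim UnE imageE)
      fix s assume "x = fst (V s)" "s \<in> {..<S}"
      then have "?A \<omega>" using x(2) by (auto simp: VY)
      then show ?thesis by blast
    next
      fix p assume p: "x = (case p of (s, j) \<Rightarrow> ?mix j (fst (V s)) (snd (V s)))" "p \<in> {..<S} \<times> {..<r}"
      then have "?B \<omega>" using x(2) by (intro bexI [of _ p]) (auto simp: VY)
      then show ?thesis by blast
    next
      fix t assume "x = fst (Y t)" "t \<in> {..<m}"
      then have "?C \<omega>" using x(2) by (auto simp: VY)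
      then show ?thesis by blast
    next
      fix p assume p: "x = (case p of (t, j, \<psi>) \<Rightarrow> ?mix j (fst (V (sel f \<pi> V j))) (\<psi> (Y t)))"
        "p \<in> {..<m} \<times> {..<r} \<times> probes n"
      obtain t j \<psi> where tj: "p = (t, j, \<psi>)" by (cases p)
      have "?D \<omega>"
        using p x(2) sel(1) [of f \<pi> V j]
        by (intro bexI [of _ "(sel f \<pi> V j, j, t, \<psi>)"]) (auto simp: VY tj)
      then show ?thesis by blast
    qed
  qed simp
  also have "\<dots> \<le> freq ?\<Omega> ?A + (freq ?\<Omega> ?B + (freq ?\<Omega> ?C + freq ?\<Omega> ?D))"
    using freq_disj_le [of ?\<Omega> ?A "\<lambda>\<omega>. ?B \<omega> \<or> ?C \<omega> \<or> ?D \<omega>"]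
      freq_disj_le [of ?\<Omega> ?B "\<lambda>\<omega>. ?C \<omega> \<or> ?D \<omega>"] freq_disj_le [of ?\<Omega> ?C ?D]
    by simp
  also have "freq ?\<Omega> ?A \<le> real (card {..<S}) * e"
  proof (rule freq_Bex_le_card)
    fix s assume "s \<in> {..<S}"
    then have "freq ?\<Omega> (\<lambda>\<omega>. ?E (fst (fst \<omega> s))) = freq (cube n \<times> cube n) (\<lambda>v. ?E (fst v))"
      using freq_fst [of searches samples "\<lambda>V. ?E (fst (V s))"]
        freq_PiE_at [of "{..<S}" "cube n \<times> cube n" s "\<lambda>v. ?E (fst v)"]
      by (simp add: case_prod_unfold searches_def [symmetric])
    then show "freq ?\<Omega> (\<lambda>\<omega>. ?E (fst (fst \<omega> s))) \<le> e"
      using freq_fst [of "cube n" "cube n" ?E] by (simp add: case_prod_unfold e_def)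
  qed simp_all
  also have "freq ?\<Omega> ?B \<le> real (card ({..<S} \<times> {..<r})) * e"
  proof (rule freq_Bex_le_card)
    fix p assume p: "p \<in> {..<S} \<times> {..<r}"
    let ?P = "\<lambda>v. ?E (?mix (snd p) (fst v) (snd v))"
    have "freq ?\<Omega> (\<lambda>\<omega>. ?P (fst \<omega> (fst p))) = freq (cube n \<times> cube n) ?P"
      using freq_fst [of searches samples "\<lambda>V. ?P (V (fst p))"]
        freq_PiE_at [of "{..<S}" "cube n \<times> cube n" "fst p" ?P] p
      by (simp add: case_prod_unfold searches_def [symmetric] mem_Times_iff)
    then show "freq ?\<Omega> (\<lambda>\<omega>. ?P (fst \<omega> (fst p))) \<le> e"
      using freq_mix [of n ?E "\<lambda>i. \<pi> i = snd p"] by (simp add: case_prod_unfold e_def)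
  qed simp_all
  also have "freq ?\<Omega> ?C \<le> real (card {..<m}) * e"
  proof (rule freq_Bex_le_card)
    fix t assume "t \<in> {..<m}"
    then have "freq ?\<Omega> (\<lambda>\<omega>. ?E (fst (snd \<omega> t))) = freq (triples n) (\<lambda>v. ?E (fst v))"
      using freq_snd [of searches samples "\<lambda>Y. ?E (fst (Y t))"]
        freq_PiE_at [of "{..<m}" "triples n" t "\<lambda>v. ?E (fst v)"]
      by (simp add: case_prod_unfold samples_def [symmetric])
    then show "freq ?\<Omega> (\<lambda>\<omega>. ?E (fst (snd \<omega> t))) \<le> e"
      using freq_triple1 [of n ?E] by (simp add: case_prod_unfold e_def)
  qed simp_all
  also have "freq ?\<Omega> ?D \<le> real (card ({..<S} \<times> {..<r} \<times> {..<m} \<times> probes n)) * e"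
  proof (rule freq_Bex_le_card)
    fix p assume "p \<in> {..<S} \<times> {..<r} \<times> {..<m} \<times> probes n"
    then obtain s j t \<psi> where p: "p = (s, j, t, \<psi>)" "s < S" "t < m" "\<psi> \<in> probes n" by auto
    have "freq ?\<Omega> (\<lambda>(V, Y). ?E (?mix j (fst (V s)) (\<psi> (Y t))))
        = freq ((cube n \<times> cube n) \<times> triples n) (\<lambda>(v, y). ?E (?mix j (fst v) (\<psi> y)))"
      by (rule freq_search_sample [OF p(2,3)])
    also have "\<dots> = freq ((cube n \<times> cube n) \<times> cube n) (\<lambda>(v, y). ?E (?mix j (fst v) y))"
    proof (rule freq_Times_cong_snd)
      fix v
      show "freq (triples n) (\<lambda>y. case (v, y) of (v, y) \<Rightarrow> ?E (?mix j (fst v) (\<psi> y)))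
          = freq (cube n) (\<lambda>y. case (v, y) of (v, y) \<Rightarrow> ?E (?mix j (fst v) y))"
        using freq_probe [OF p(4), of "\<lambda>y. ?E (?mix j (fst v) y)"] by simp
    qed simp_all
    also have "\<dots> = freq (cube n \<times> cube n) (\<lambda>(x, y). ?E (?mix j x y))"
    proof (rule freq_Times_cong_fst)
      fix y
      show "freq (cube n \<times> cube n) (\<lambda>v. case (v, y) of (v, y) \<Rightarrow> ?E (?mix j (fst v) y))
          = freq (cube n) (\<lambda>x. case (x, y) of (x, y) \<Rightarrow> ?E (?mix j x y))"
        using freq_fst [of "cube n" "cube n" "\<lambda>x. ?E (?mix j x y)"] by (simp add: case_prod_unfold)
    qed simp_all
    also have "\<dots> = e" unfolding e_def by (rule freq_mix)
    finally show "freq ?\<Omega> (\<lambda>\<omega>. ?E (?mix (fst (snd p)) (fst (fst \<omega> (fst p)))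
        (snd (snd (snd p)) (snd \<omega> (fst (snd (snd p))))))) \<le> e"
      by (simp add: p case_prod_unfold)
  qed simp_all
  also have "real (card ({..<S} \<times> {..<r} \<times> {..<m} \<times> probes n)) * e \<le> (5 * real S * real r * real m) * e"
  proof (rule mult_right_mono [OF _ e0])
    have "real S * (real r * (real m * real (card (probes n)))) \<le> real S * (real r * (real m * 5))"
      using card_probes [of n] by (intro mult_left_mono) auto
    then show "real (card ({..<S} \<times> {..<r} \<times> {..<m} \<times> probes n)) \<le> 5 * real S * real r * real m"
      by (simp add: card_cartesian_product mult_ac)
  qed
  finally show ?thesis by (simp add: card_cartesian_product algebra_simps)
qed

text \<open>One summand per source of failure: two variables of the truncated list share a block,
  unfound blocks matter on a sample, or \<open>f\<close> and its truncation differ at a potential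
  query.\<close>

lemma rejects_Decision_List_le:
  assumes f: "f \<in> Decision_List n"
  shows "freq (partitions \<times> searches \<times> samples) (\<lambda>\<omega>. \<not> accepts f \<omega>)
    \<le> real k ^ 2 / real r + real m * real r / (real S + 1)
      + (real S + real S * real r + real m + 5 * real S * real r * real m) / 2 ^ k"
proof -
  obtain M d where M: "length M \<le> k" "fst ` set M \<subseteq> {..<n}"
    and close: "freq (cube n) (\<lambda>x. f x \<noteq> dl_default M d x) \<le> 1 / 2 ^ k"
    using Decision_List_truncate [OF f] by blast
  let ?g = "dl_default M d"
  let ?vars = "fst ` set M"
  let ?Q = "real S + real S * real r + real m + 5 * real S * real r * real m"
  let ?c = "real m * real r / (real S + 1) + ?Q / 2 ^ k"
  let ?\<Omega> = "partitions \<times> searches \<times> samples"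
  have c0: "0 \<le> ?c" by simp
  have "freq ?\<Omega> (\<lambda>\<omega>. \<not> accepts f \<omega>) \<le> freq ?\<Omega> (\<lambda>\<omega>. (case \<omega> of (\<pi>, VY) \<Rightarrow> \<not> inj_on \<pi> ?vars)
      \<or> (inj_on (fst \<omega>) ?vars \<and> \<not> accepts f \<omega>))"
    by (rule freq_mono) (auto simp: case_prod_unfold)
  also have "\<dots> \<le> freq ?\<Omega> (\<lambda>(\<pi>, VY). \<not> inj_on \<pi> ?vars)
      + freq ?\<Omega> (\<lambda>\<omega>. inj_on (fst \<omega>) ?vars \<and> \<not> accepts f \<omega>)"
    by (rule freq_disj_le) simp
  also have "freq ?\<Omega> (\<lambda>(\<pi>, VY). \<not> inj_on \<pi> ?vars) = freq partitions (\<lambda>\<pi>. \<not> inj_on \<pi> ?vars)"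
    by (rule freq_fst) simp_all
  also have "\<dots> \<le> freq partitions (\<lambda>\<pi>. \<exists>p\<in>{p \<in> ?vars \<times> ?vars. fst p \<noteq> snd p}. \<pi> (fst p) = \<pi> (snd p))"
    by (rule freq_mono) (auto simp: inj_on_def)
  also have "\<dots> \<le> real (card {p \<in> ?vars \<times> ?vars. fst p \<noteq> snd p}) * (1 / real (card {..<r}))"
    unfolding partitions_def
  proof (rule freq_Bex_le_card)
    fix p assume "p \<in> {p \<in> ?vars \<times> ?vars. fst p \<noteq> snd p}"
    then show "freq ({..<n} \<rightarrow>\<^sub>E {..<r}) (\<lambda>\<pi>. \<pi> (fst p) = \<pi> (snd p)) \<le> 1 / real (card {..<r})"
      using M(2) r_pos by (intro freq_PiE_collision) auto
  qed (simp_all add: finite_PiE)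
  also have "\<dots> \<le> real k ^ 2 * (1 / real (card {..<r}))"
  proof (rule mult_right_mono)
    have "card {p \<in> ?vars \<times> ?vars. fst p \<noteq> snd p} \<le> card (?vars \<times> ?vars)"
      by (rule card_mono) auto
    also have "\<dots> \<le> k * k"
      using order_trans [OF card_image_le [of "set M" fst] order_trans [OF card_length M(1)]]
      by (simp add: card_cartesian_product mult_mono)
    finally show "real (card {p \<in> ?vars \<times> ?vars. fst p \<noteq> snd p}) \<le> real k ^ 2"
      by (simp add: power2_eq_square flip: of_nat_mult)
  qed simp
  also have "freq ?\<Omega> (\<lambda>\<omega>. inj_on (fst \<omega>) ?vars \<and> \<not> accepts f \<omega>) \<le> ?c"
  proof (rule freq_Times_le)
    fix \<pi> assume \<pi>: "\<pi> \<in> partitions"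
    show "freq (searches \<times> samples) (\<lambda>VY. inj_on (fst (\<pi>, VY)) ?vars \<and> \<not> accepts f (\<pi>, VY)) \<le> ?c"
    proof (cases "inj_on \<pi> ?vars")
      case True
      have "freq (searches \<times> samples) (\<lambda>VY. inj_on (fst (\<pi>, VY)) ?vars \<and> \<not> accepts f (\<pi>, VY))
          \<le> freq (searches \<times> samples) (\<lambda>VY. (case VY of (V, Y) \<Rightarrow> \<not> accepts ?g (\<pi>, V, Y)) \<or>
            (case VY of (V, Y) \<Rightarrow> accepts f (\<pi>, V, Y) \<noteq> accepts ?g (\<pi>, V, Y)))"
        by (rule freq_mono) auto
      also have "\<dots> \<le> freq (searches \<times> samples) (\<lambda>(V, Y). \<not> accepts ?g (\<pi>, V, Y))
          + freq (searches \<times> samples) (\<lambda>(V, Y). accepts f (\<pi>, V, Y) \<noteq> accepts ?g (\<pi>, V, Y))"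
        by (rule freq_disj_le) simp
      also have "freq (searches \<times> samples) (\<lambda>(V, Y). \<not> accepts ?g (\<pi>, V, Y))
          \<le> real m * real r / (real S + 1)"
        using M True \<pi> by (intro freq_rejects_short_list) (auto simp: partitions_def PiE_iff)
      also have "freq (searches \<times> samples) (\<lambda>(V, Y). accepts f (\<pi>, V, Y) \<noteq> accepts ?g (\<pi>, V, Y))
          \<le> ?Q * freq (cube n) (\<lambda>x. f x \<noteq> ?g x)"
        by (rule freq_accepts_differently)
      also have "\<dots> \<le> ?Q * (1 / 2 ^ k)"
        by (rule mult_left_mono [OF close]) simp
      finally show ?thesis by simp
    next
      case False
      then show ?thesis using c0 by (simp add: freq_False)
    qed
  qed (use c0 in simp_all)
  finally show ?thesis by simp
qed

end

section \<open>Choice of parameters\<close>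

lemma prob_cube: "measure_pmf.prob (pmf_of_set (cube n)) {x. P x} = freq (cube n) P"
proof -
  have "cube n \<inter> {x. P x} = {x \<in> cube n. P x}" by auto
  then show ?thesis by (simp add: measure_pmf_of_set freq_def)
qed

text \<open>With \<open>r\<close> a power of two, so is the size of the whole sample space, and coin
  tosses realise the uniform distribution exactly.\<close>

lemma (in dl_tester) tester_if_parameters:
  assumes r: "r = 2 ^ \<rho>"
    and complete: "real k ^ 2 / real r + real m * real r / (real S + 1)
      + (real S + real S * real r + real m + 5 * real S * real r * real m) / 2 ^ k \<le> 1 / 3"
    and sound: "\<And>f. far n \<epsilon> (Decision_List n) f \<Longrightarrow> freq (partitions \<times> searches \<times> samples) (accepts f) \<le> 1 / 3"
  shows "\<exists>A. two_sided_tester n \<epsilon> (Decision_List n) A \<and>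
    num_queries A \<le> (S + S * r) + (m + m * r * 5)"
proof -
  let ?\<Omega> = "partitions \<times> searches \<times> samples"
  have "card partitions = 2 ^ (\<rho> * n)"
    unfolding partitions_def by (simp add: card_PiE r flip: power_mult)
  then have card: "card ?\<Omega> = 2 ^ (\<rho> * n + ((n + n) * S + (n + n + n) * m))"
    by (simp add: card_cartesian_product searches_def samples_def card_PiE card_cube
        flip: power_add power_mult)
  obtain A where A: "query_points A \<subseteq> cube n" "num_queries A \<le> (S + S * r) + (m + m * r * 5)"
    "\<And>f. pmf (run A f) True = freq ?\<Omega> (\<lambda>\<omega>. accepts f \<omega>)"
  proof -
    have "\<exists>A. query_points A \<subseteq> cube n \<and> num_queries A \<le> (S + S * r) + (m + m * r * 5) \<and>
      (\<forall>f. run A f = return_pmf (accepts f \<omega>))" if \<omega>: "\<omega> \<in> ?\<Omega>" for \<omega>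
    proof -
      obtain \<pi> V Y where "\<omega> = (\<pi>, V, Y)" by (cases \<omega>)
      with \<omega> show ?thesis using decision_algorithm [of V Y \<pi>] by simp
    qed
    from randomized_algorithm [where dec = "\<lambda>\<omega> f. accepts f \<omega>", OF _ card this]
    have "\<exists>A. query_points A \<subseteq> cube n \<and> num_queries A \<le> (S + S * r) + (m + m * r * 5) \<and>
      (\<forall>f. pmf (run A f) True = freq ?\<Omega> (\<lambda>\<omega>. accepts f \<omega>))"
      by simp
    then show thesis using that by blast
  qed
  have fin: "finite ?\<Omega>" "?\<Omega> \<noteq> {}" by simp_all
  have "2 / 3 \<le> pmf (run A f) True" if "f \<in> Decision_List n" for f
    using rejects_Decision_List_le [OF that] complete freq_not [OF fin, of "accepts f"]
    unfolding A(3) by linarith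
  moreover have "2 / 3 \<le> pmf (run A f) False" if "far n \<epsilon> (Decision_List n) f" for f
    using sound [OF that] by (simp add: pmf_False_conv_True A(3))
  ultimately show ?thesis
    using A(1,2) unfolding two_sided_tester_def by blast
qed

lemma power2_between:
  assumes "0 < (a :: nat)"
  obtains \<rho> where "a \<le> 2 ^ \<rho>" "(2 :: nat) ^ \<rho> \<le> 2 * a"
proof -
  define \<rho> where "\<rho> = (LEAST \<rho>. a \<le> 2 ^ \<rho>)"
  have "a \<le> 2 ^ a" by (rule less_imp_le [OF less_exp])
  then have 1: "a \<le> 2 ^ \<rho>" unfolding \<rho>_def by (rule LeastI)
  have "(2 :: nat) ^ \<rho> \<le> 2 * a"
  proof (cases \<rho>)
    case 0
    then show ?thesis using assms by simp
  next
    case (Suc \<rho>')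
    then have "\<not> a \<le> 2 ^ \<rho>'" unfolding \<rho>_def by (intro not_less_Least) simp
    then show ?thesis by (simp add: Suc)
  qed
  with 1 show thesis by (rule that)
qed

text \<open>There are about \<open>poly k * 4 ^ l\<close> potential queries, far fewer than \<open>2 ^ k\<close>; \<open>r\<close> beats
  the \<open>k ^ 2\<close> pairs of variables, \<open>m\<close> the number of hypotheses, and \<open>S\<close> the \<open>m * r\<close> ways to miss a
  relevant block.\<close>

lemma tester_for_power2:
  assumes n: "0 < n" and l: "0 < l" and \<epsilon>: "1 / 2 ^ l \<le> \<epsilon>"
  shows "\<exists>A. two_sided_tester n \<epsilon> (Decision_List n) A \<and>
    num_queries A \<le> 1152 * 18 ^ 3 * 200 ^ 7 * l ^ 7 * 2 ^ l"
proof -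
  \<comment> \<open>Nine times the number of potential queries will be at most 2 ^ (188 + 12 * l),
    which is at most 2 ^ k because \<open>l\<close> is positive.\<close>
  define k where "k = 200 * l"
  have k: "200 \<le> k" using l by (simp add: k_def)
  \<comment> \<open>The factor 9 bounds the probability of a collision among \<open>k\<close>
    variables by 1/9, a third of the allowed error.\<close>
  obtain \<rho> where \<rho>: "9 * k ^ 2 \<le> 2 ^ \<rho>" "(2 :: nat) ^ \<rho> \<le> 2 * (9 * k ^ 2)"
    by (rule power2_between [of "9 * k ^ 2"]) (use k in auto)
  define r :: nat where "r = 2 ^ \<rho>"
  have r: "9 * k ^ 2 \<le> r" "r \<le> 18 * k ^ 2" using \<rho> by (simp_all add: r_def)
  \<comment> \<open>For \<eta> = 2 ^ -l / (4 * r) this gives \<eta> * m = 4 * k, enough to detect a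
    bad block function, and 2 ^ -l / 2 * m = 8 * k * r, twice the bound 4 * r * k on the logarithm
    of \<open>(4 * r + 1) ^ k\<close>.\<close>
  define m where "m = 2 ^ l * (16 * k * r)"
  define S where "S = 9 * r * m"
  have "200 * 200 \<le> k ^ 2" using mult_le_mono [OF k k] by (simp add: power2_eq_square)
  then have r_ge: "360000 \<le> r" using r(1) by linarith
  have pos: "0 < r" "0 < m" "0 < S" using r_ge k by (simp_all add: m_def S_def)
  interpret dl_tester n r S m k
    by unfold_locales (use n pos in auto)
  define \<epsilon>' :: real where "\<epsilon>' = 1 / 2 ^ l"
  have e': "0 < \<epsilon>'" "\<epsilon>' \<le> 1" by (simp_all add: \<epsilon>'_def)
  have m_eq: "real m = 16 * real k * real r / \<epsilon>'" by (simp add: m_def \<epsilon>'_def)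
  have one_third: "2 * exp (- x) \<le> 1 / 3" if "5 \<le> x" for x :: real
  proof -
    have "6 \<le> exp x" using exp_ge_add_one_self [of x] that by linarith
    then show ?thesis by (simp add: exp_minus field_simps)
  qed
  have sound: "freq (partitions \<times> searches \<times> samples) (accepts f) \<le> 1 / 3"
    if far: "far n \<epsilon> (Decision_List n) f" for f
  proof (rule accepts_far_le [where \<epsilon> = \<epsilon>' and \<eta> = "\<epsilon>' / (4 * real r)"])
    show "\<epsilon>' \<le> freq (cube n) (\<lambda>x. f x \<noteq> g x)" if "g \<in> Decision_List n" for g
      using far that \<epsilon> unfolding far_def \<epsilon>'_def prob_cube by (meson order_trans)
    show "0 \<le> \<epsilon>' / (4 * real r)" using e' by simp
    have "\<epsilon>' / (4 * real r) \<le> 1 / (4 * 360000)"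
      using e' r_ge by (intro frac_le) auto
    then show eta: "\<epsilon>' / (4 * real r) \<le> 1 / 200" by simp
    show "4 * (\<epsilon>' / (4 * real r)) * real r \<le> \<epsilon>'" using pos by simp
    show "\<epsilon>' \<le> 1" by (rule e')
    have pow: "(1 - x) ^ m \<le> exp (- (x * real m))" if "x \<le> 1" for x :: real
    proof -
      have "(1 - x) ^ m \<le> exp (- x) ^ m"
        using exp_ge_add_one_self [of "- x"] that by (intro power_mono) auto
      also have "\<dots> = exp (- (x * real m))" by (simp add: mult.commute flip: exp_of_nat_mult)
      finally show ?thesis .
    qed
    have "\<epsilon>' / (4 * real r) * real m = 4 * real k" using e' pos by (simp add: m_eq field_simps)
    then have "(1 - \<epsilon>' / (4 * real r)) ^ m \<le> exp (- (4 * real k))"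
      using pow [of "\<epsilon>' / (4 * real r)"] eta by simp
    moreover have "exp (- (4 * real k)) \<le> 1 / 3"
      using one_third [of "4 * real k"] k exp_gt_zero [of "- (4 * real k)"] by linarith
    ultimately show "(1 - \<epsilon>' / (4 * real r)) ^ m \<le> 1 / 3" by linarith
    have "4 * real r + 1 \<le> exp (4 * real r)"
      using exp_ge_add_one_self [of "4 * real r"] by linarith
    then have "(4 * real r + 1) ^ k \<le> exp (4 * real r) ^ k"
      by (intro power_mono) auto
    also have "\<dots> = exp (4 * real r * real k)" by (simp add: mult.commute flip: exp_of_nat_mult)
    finally have A: "(4 * real r + 1) ^ k \<le> exp (4 * real r * real k)" .
    have "\<epsilon>' / 2 * real m = 8 * real r * real k" using e' by (simp add: m_eq field_simps)
    then have B: "(1 - \<epsilon>' / 2) ^ m \<le> exp (- (8 * real r * real k))"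
      using pow [of "\<epsilon>' / 2"] e' by (simp only: minus_mult_left [symmetric])
    have "2 * (4 * real r + 1) ^ k * (1 - \<epsilon>' / 2) ^ m
        \<le> 2 * exp (4 * real r * real k) * exp (- (8 * real r * real k))"
      using A B e' by (intro mult_mono) auto
    also have "\<dots> = 2 * exp (- (4 * real r * real k))" by (simp flip: exp_add)
    also have "\<dots> \<le> 1 / 3"
    proof (rule one_third)
      have "4 * 360000 * 200 \<le> 4 * real r * real k"
        using r_ge k by (intro mult_mono) auto
      then show "5 \<le> 4 * real r * real k" by linarith
    qed
    finally show "2 * (4 * real r + 1) ^ k * (1 - \<epsilon>' / 2) ^ m \<le> 1 / 3" .
  qed
  have m_le: "m \<le> 2 ^ l * (16 * k * (18 * k ^ 2))" unfolding m_def using r(2) by simp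
  have complete: "real k ^ 2 / real r + real m * real r / (real S + 1)
      + (real S + real S * real r + real m + 5 * real S * real r * real m) / 2 ^ k \<le> 1 / 3"
  proof -
    have "real (9 * k ^ 2) \<le> real r" using r(1) by (rule of_nat_mono)
    then have 1: "real k ^ 2 / real r \<le> 1 / 9" using pos by (simp add: field_simps)
    have "9 * (real m * real r) \<le> real S + 1" by (simp add: S_def)
    then have 2: "real m * real r / (real S + 1) \<le> 1 / 9" by (simp add: divide_le_eq)
    have "S + S * r + m + 5 * S * r * m \<le> 8 * (S * r * m)"
    proof -
      have rm: "1 \<le> r * m" "1 \<le> m" "1 \<le> S * r" using pos by simp_all
      have "S \<le> S * r * m" using mult_le_mono2 [OF rm(1), of S] by (simp add: mult.assoc)
      moreover have "S * r \<le> S * r * m" using mult_le_mono2 [OF rm(2), of "S * r"] by simp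
      moreover have "m \<le> S * r * m" using mult_le_mono1 [OF rm(3), of m] by simp
      moreover have "5 * S * r * m = 5 * (S * r * m)" by (simp only: mult.assoc)
      ultimately show ?thesis by linarith
    qed
    also have "8 * (S * r * m) = 72 * r ^ 2 * m ^ 2" by (simp add: S_def power2_eq_square)
    also have "\<dots> \<le> 72 * (18 * k ^ 2) ^ 2 * (2 ^ l * (16 * k * (18 * k ^ 2))) ^ 2"
      using r(2) m_le by (intro mult_le_mono power_mono) auto
    also have "\<dots> = 72 * 18 ^ 4 * 16 ^ 2 * 200 ^ 10 * 4 ^ l * l ^ 10"
      by (simp add: k_def power_mult_distrib power_mult [symmetric] mult.commute [of l] flip: power_add)
        (simp add: power_mult)
    also have "\<dots> \<le> 72 * 18 ^ 4 * 16 ^ 2 * 200 ^ 10 * 4 ^ l * (2 ^ l) ^ 10"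
      by (intro mult_le_mono power_mono) (simp_all add: less_imp_le [OF less_exp])
    also have "\<dots> = 72 * 18 ^ 4 * 16 ^ 2 * 200 ^ 10 * 2 ^ (12 * l)"
    proof -
      have "(4 :: nat) ^ l = 2 ^ (2 * l)" by (simp add: power_mult)
      then show ?thesis by (simp add: mult.commute [of l] flip: power_mult power_add)
    qed
    finally have "9 * (S + S * r + m + 5 * S * r * m)
        \<le> 9 * (72 * 18 ^ 4 * 16 ^ 2 * 200 ^ 10 * 2 ^ (12 * l))"
      by (rule mult_le_mono2)
    also have "\<dots> \<le> 2 ^ 188 * 2 ^ (12 * l)" by simp
    also have "\<dots> \<le> 2 ^ k"
      unfolding power_add [symmetric] using l by (intro power_increasing) (auto simp: k_def)
    finally have "real (9 * (S + S * r + m + 5 * S * r * m)) \<le> real (2 ^ k)" by (rule of_nat_mono)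
    then have 3: "(real S + real S * real r + real m + 5 * real S * real r * real m) / 2 ^ k \<le> 1 / 9"
      by (simp add: field_simps)
    show ?thesis using 1 2 3 by linarith
  qed
  obtain A where A: "two_sided_tester n \<epsilon> (Decision_List n) A"
    "num_queries A \<le> (S + S * r) + (m + m * r * 5)"
    using tester_if_parameters [OF r_def complete sound] by blast
  note A(2)
  also have "(S + S * r) + (m + m * r * 5) \<le> 8 * (S * r)"
  proof -
    have "S \<le> S * r" "m \<le> S" "m * r \<le> S * r" using pos by (simp_all add: S_def)
    then show ?thesis by linarith
  qed
  also have "\<dots> = 72 * r ^ 2 * m" by (simp add: S_def power2_eq_square)
  also have "\<dots> \<le> 72 * (18 * k ^ 2) ^ 2 * (2 ^ l * (16 * k * (18 * k ^ 2)))"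
    using r(2) m_le by (intro mult_le_mono power_mono) auto
  also have "\<dots> = 1152 * 18 ^ 3 * 200 ^ 7 * l ^ 7 * 2 ^ l"
    by (simp add: k_def power_mult_distrib flip: power_mult) (simp add: eval_nat_numeral)
  finally show ?thesis using A(1) by blast
qed

lemma Decision_List_0: "Decision_List 0 = {}"
proof (rule ccontr)
  assume "\<not> ?thesis"
  then obtain f L where L: "\<forall>(i, \<xi>, a) \<in> set L. i < (0 :: nat)" "\<forall>x \<in> cube 0. dl_eval L x = Some (f x)"
    unfolding Decision_List_def by blast
  from L(1) have "L = []" by (cases L) auto
  with L(2) cube_nonempty [of 0] show False by auto
qed

lemma poly_X_plus_1_power: "poly ([:1, 1:] ^ k) (x :: real) = (1 + x) ^ k"
  by (simp add: poly_power)

lemma decision_list_tester_exists: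
  fixes \<epsilon> :: real
  assumes \<epsilon>: "0 < \<epsilon>"
  shows "\<exists>A. two_sided_tester n \<epsilon> (Decision_List n) A \<and>
    real (num_queries A)
      \<le> (1152 * 18 ^ 3 * 200 ^ 7 * 2 ^ 9) * ((1 / \<epsilon>) * poly ([:1, 1:] ^ 8) (ln (1 / \<epsilon>)))"
proof -
  let ?c = "1152 * 18 ^ 3 * 200 ^ 7 :: real"
  \<comment> \<open>For \<epsilon> > 1 the logarithm is negative. The even degree 8, one more than
    the construction yields, keeps the bound nonnegative there.\<close>
  have rhs: "0 \<le> (?c * 2 ^ 9) * ((1 / \<epsilon>) * poly ([:1, 1:] ^ 8) (ln (1 / \<epsilon>)))"
    unfolding poly_X_plus_1_power using \<epsilon> by (intro mult_nonneg_nonneg) auto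
  consider "n = 0" | "0 < n" "1 < \<epsilon>" | "0 < n" "\<epsilon> \<le> 1" by linarith
  then show ?thesis
  proof cases
    case 1
    \<comment> \<open>Without variables there is no decision list, so every function is far and has
      to be rejected.\<close>
    show ?thesis
      using rhs Decision_List_0 unfolding 1 by (intro exI [of _ "Return False"]) (simp add: two_sided_tester_def)
  next
    case 2
    have "dl_default [] True \<in> Decision_List n"
      by (rule dl_default_in_Decision_List [OF 2(1)]) simp
    \<comment> \<open>The class is nonempty and no distance exceeds 1, so nothing is far.\<close>
    then have "\<not> far n \<epsilon> (Decision_List n) f" for f
      unfolding far_def using 2(2) measure_pmf.prob_le_1 [of "pmf_of_set (cube n)"]
      by (meson not_le order_trans)
    then show ?thesis
      using rhs by (intro exI [of _ "Return True"]) (simp add: two_sided_tester_def)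
  next
    case 3
    define \<Lambda> where "\<Lambda> = ln (1 / \<epsilon>)"
    have \<Lambda>: "0 \<le> \<Lambda>" using 3 \<epsilon> by (simp add: \<Lambda>_def)
    \<comment> \<open>The added 1 keeps \<open>l\<close> positive at \<epsilon> = 1, at the price of
      2 ^ l \<le> 4 / \<epsilon>.\<close>
    define l where "l = nat \<lceil>log 2 (1 / \<epsilon>)\<rceil> + 1"
    have log0: "0 \<le> log 2 (1 / \<epsilon>)" using 3 \<epsilon> by simp
    have l_ge: "log 2 (1 / \<epsilon>) \<le> real l" and l_le: "real l \<le> log 2 (1 / \<epsilon>) + 2"
      using log0 unfolding l_def by linarith+
    have "1 / \<epsilon> = 2 powr log 2 (1 / \<epsilon>)" using \<epsilon> by simp
    also have "\<dots> \<le> 2 powr real l" using l_ge by simp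
    finally have "1 / \<epsilon> \<le> 2 ^ l" by (simp add: powr_realpow)
    then have "1 / 2 ^ l \<le> \<epsilon>" using \<epsilon> by (simp add: field_simps)
    moreover have "0 < l" by (simp add: l_def)
    ultimately obtain A where A: "two_sided_tester n \<epsilon> (Decision_List n) A"
      "num_queries A \<le> 1152 * 18 ^ 3 * 200 ^ 7 * l ^ 7 * 2 ^ l"
      using tester_for_power2 [OF 3(1)] by blast
    have "2 ^ l = 2 powr real l" by (simp add: powr_realpow)
    also have "\<dots> \<le> 2 powr (log 2 (1 / \<epsilon>) + 2)" using l_le by simp
    also have "\<dots> = 4 / \<epsilon>" using \<epsilon> by (simp add: powr_add)
    finally have pow: "2 ^ l \<le> 4 / \<epsilon>" .
    have "log 2 (1 / \<epsilon>) \<le> 2 * \<Lambda>"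
    proof -
      have "\<Lambda> / ln 2 \<le> \<Lambda> / (1 / 2)"
        using \<Lambda> ln_le_minus_one [of "1 / 2 :: real"] by (intro divide_left_mono) (auto simp: ln_div)
      then show ?thesis by (simp add: log_def \<Lambda>_def)
    qed
    then have lin: "real l \<le> 2 * (1 + \<Lambda>)" using l_le by simp
    have "real (num_queries A) \<le> real (1152 * 18 ^ 3 * 200 ^ 7 * l ^ 7 * 2 ^ l)"
      using A(2) by (rule of_nat_mono)
    also have "\<dots> = ?c * (real l ^ 7 * 2 ^ l)" by simp
    also have "\<dots> \<le> ?c * ((2 * (1 + \<Lambda>)) ^ 7 * (4 / \<epsilon>))"
      using lin pow \<Lambda> by (intro mult_left_mono mult_mono power_mono) auto
    also have "\<dots> = (?c * 2 ^ 9) * ((1 / \<epsilon>) * (1 + \<Lambda>) ^ 7)"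
      unfolding power_mult_distrib by simp
    also have "\<dots> \<le> (?c * 2 ^ 9) * ((1 / \<epsilon>) * (1 + \<Lambda>) ^ 8)"
      using \<Lambda> \<epsilon> by (intro mult_left_mono power_increasing) auto
    finally show ?thesis
      using A(1) unfolding poly_X_plus_1_power \<Lambda>_def by blast
  qed
qed

theorem theorem21:
  "\<exists>(A :: real \<Rightarrow> nat \<Rightarrow> (nat \<Rightarrow> bool) oracle_alg) (c :: real) (p :: real poly).
     \<forall>\<epsilon>>0. \<forall>n.
       two_sided_tester n \<epsilon> (Decision_List n) (A \<epsilon> n) \<and>
       real (num_queries (A \<epsilon> n)) \<le> c * ((1/\<epsilon>) * poly p (ln (1/\<epsilon>)))"
proof -
  let ?c = "1152 * 18 ^ 3 * 200 ^ 7 * 2 ^ 9 :: real" and ?p = "[:1, 1:] ^ 8 :: real poly"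
  let ?good = "\<lambda>\<epsilon> n A. two_sided_tester n \<epsilon> (Decision_List n) A \<and>
    real (num_queries A) \<le> ?c * ((1/\<epsilon>) * poly ?p (ln (1/\<epsilon>)))"
  \<comment> \<open>The bound depends on \<epsilon> alone, so \<open>c\<close> and \<open>p\<close>
    are fixed while the tester is chosen separately for each \<epsilon> and
    \<open>n\<close>.\<close>
  have "\<forall>\<epsilon>>0. \<forall>n. ?good \<epsilon> n (SOME A. ?good \<epsilon> n A)"
    by (intro allI impI someI_ex [of "?good _ _"] decision_list_tester_exists)
  then show ?thesis
    by (intro exI [of _ "\<lambda>\<epsilon> n. SOME A. ?good \<epsilon> n A"] exI [of _ ?c] exI [of _ ?p])
qed

end
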